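(* Let $\mathbf{X}_1,\ldots,\mathbf{X}_n$ be i.i.d. with law $\mu\in\mathcal{P}_{ac}(\mathbb{R}^d)$, let $\mathcal{H}_n^d=\{\mathbf{h}_1^d,\ldots,\mathbf{h}_n^d\}\subset[0,1]^d$ be a fixed set of $n$ points, and let $\hat R_n$ be the empirical rank map of $\mathbf{X}_1,\ldots,\mathbf{X}_n$ with respect to $\mathcal{H}_n^d$. Let $\mathbf{X}^{(n)}_{(\cdot)}$ be an order statistic of $\{\mathbf{X}_1,\ldots,\mathbf{X}_n\}$, i.e. any fixed, arbitrary ordered version of this collection (for example, $\mathbf{X}^{(n)}_{(\cdot)}=(\mathbf{X}_{(1)},\ldots,\mathbf{X}_{(n)})$ where the first coordinate of $\mathbf{X}_{(i)}$ is the $i$-th order statistic of the $n$-tuple of first coordinates). Then: (i) The order statistic $\mathbf{X}^{(n)}_{(\cdot)}$ is complete and sufficient (for the family of laws of $(\mathbf{X}_1,\ldots,\mathbf{X}_n)$ indexed by $\mu\in\mathcal{P}_{ac}(\mathbb{R}^d)$). (ii) The vector $(\hat R_n(\mathbf{X}_1),\ldots,\hat R_n(\mathbf{X}_n))$ is uniformly distributed over the $n!$ permutations of the fixed grid $\mathcal{H}_n^d$. (iii) $(\hat R_n(\mathbf{X}_1),\ldots,\hat R_n(\mathbf{X}_n))$ and $\mathbf{X}^{(n)}_{(\cdot)}$ are mutually independent.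
   Context: $\mathcal{P}_{ac}(\mathbb{R}^d)$ is the set of Lebesgue absolutely continuous probability measures on $\mathbb{R}^d$; $S_n$ is the set of permutations of $\{1,\ldots,n\}$; $\|\cdot\|$ is the Euclidean norm. Empirical rank map: let $\hat\sigma_n\in\arg\min_{\sigma\in S_n}\sum_{i=1}^n\|\mathbf{X}_i-\mathbf{h}^d_{\sigma(i)}\|^2$ (almost surely unique); then $\hat R_n(\mathbf{X}_i):=\mathbf{h}^d_{\hat\sigma_n(i)}$ for $i=1,\ldots,n$. *)

theory Defs
  imports "HOL-Probability.Probability" "HOL-Combinatorics.Permutations"
begin

definition ac_probability_measures :: "(real ^ 'd) measure set" where
  "ac_probability_measures =
     {\<mu>. prob_space \<mu> \<and> sets \<mu> = sets borel \<and> absolutely_continuous lborel \<mu>}"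

text \<open>Samples of size \<open>n\<close> are extensional functions on \<open>{1..n}\<close>.\<close>

abbreviation sample_space :: "nat \<Rightarrow> (nat \<Rightarrow> real ^ 'd) measure" where
  "sample_space n \<equiv> PiM {1..n} (\<lambda>_. borel)"

definition iid_laws :: "nat \<Rightarrow> (nat \<Rightarrow> real ^ 'd) measure set" where
  "iid_laws n = (\<lambda>\<mu>. PiM {1..n} (\<lambda>_. \<mu>)) ` ac_probability_measures"

definition rearrange :: "nat \<Rightarrow> (nat \<Rightarrow> 'a) \<Rightarrow> (nat \<Rightarrow> nat) \<Rightarrow> nat \<Rightarrow> 'a" where
  "rearrange n x \<pi> = (\<lambda>i\<in>{1..n}. x (\<pi> i))"

text \<open>
  An order statistic lists the sample in an order that depends only on the collection of the
  observations and not on their labelling. The latter is required for Lebesgue-almost every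
  sample only, so that ties (such as equal first coordinates) may be broken arbitrarily.
\<close>

definition order_statistic ::
  "nat \<Rightarrow> ((nat \<Rightarrow> real ^ 'd) \<Rightarrow> (nat \<Rightarrow> real ^ 'd)) \<Rightarrow> bool" where
  "order_statistic n T \<longleftrightarrow>
     T \<in> sample_space n \<rightarrow>\<^sub>M sample_space n \<and>
     (\<forall>x\<in>space (sample_space n). \<exists>\<pi>. \<pi> permutes {1..n} \<and> T x = rearrange n x \<pi>) \<and>
     (AE x in PiM {1..n} (\<lambda>_. lborel). \<forall>\<pi>. \<pi> permutes {1..n} \<longrightarrow> T (rearrange n x \<pi>) = T x)"

text \<open>
  The same Markov kernel \<open>K\<close> is a regular conditional distribution of the observation given
  the statistic \<open>T\<close> under every member of the family.
\<close>

definition sufficient_statistic ::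
  "'a measure set \<Rightarrow> 'a measure \<Rightarrow> 'b measure \<Rightarrow> ('a \<Rightarrow> 'b) \<Rightarrow> bool" where
  "sufficient_statistic \<P> S N T \<longleftrightarrow>
     T \<in> S \<rightarrow>\<^sub>M N \<and>
     (\<exists>K \<in> N \<rightarrow>\<^sub>M prob_algebra S. \<forall>P\<in>\<P>. \<forall>A\<in>sets S.
        AE x in P. real_cond_exp P (vimage_algebra (space S) T N) (indicator A) x
                     = measure (K (T x)) A)"

definition complete_statistic ::
  "'a measure set \<Rightarrow> 'a measure \<Rightarrow> 'b measure \<Rightarrow> ('a \<Rightarrow> 'b) \<Rightarrow> bool" where
  "complete_statistic \<P> S N T \<longleftrightarrow>
     T \<in> S \<rightarrow>\<^sub>M N \<and>
     (\<forall>g :: 'b \<Rightarrow> real. g \<in> borel_measurable N \<longrightarrow>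
        (\<forall>P\<in>\<P>. integrable P (\<lambda>x. g (T x)) \<and> (\<integral>x. g (T x) \<partial>P) = 0) \<longrightarrow>
        (\<forall>P\<in>\<P>. AE x in P. g (T x) = 0))"

definition optimal_assignments ::
  "nat \<Rightarrow> (nat \<Rightarrow> real ^ 'd) \<Rightarrow> (nat \<Rightarrow> real ^ 'd) \<Rightarrow> (nat \<Rightarrow> nat) set" where
  "optimal_assignments n h x =
     {\<sigma>. is_arg_min (\<lambda>\<sigma>. \<Sum>i=1..n. (norm (x i - h (\<sigma> i)))\<^sup>2) (\<lambda>\<sigma>. \<sigma> permutes {1..n}) \<sigma>}"

text \<open>
  The vector of empirical ranks: its \<open>i\<close>-th entry is the rank \<open>h (\<sigma> i)\<close> of the \<open>i\<close>-th observation,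
  where \<open>\<sigma>\<close> is an optimal assignment of the sample to the grid \<open>h\<close>.
\<close>

definition empirical_ranks ::
  "nat \<Rightarrow> (nat \<Rightarrow> real ^ 'd) \<Rightarrow> (nat \<Rightarrow> nat) \<Rightarrow> nat \<Rightarrow> real ^ 'd" where
  "empirical_ranks n h \<sigma> = (\<lambda>i\<in>{1..n}. h (\<sigma> i))"

definition grid_permutations :: "nat \<Rightarrow> (nat \<Rightarrow> real ^ 'd) \<Rightarrow> (nat \<Rightarrow> real ^ 'd) set" where
  "grid_permutations n h = rearrange n h ` {\<pi>. \<pi> permutes {1..n}}"

lemma card_grid_permutations:
  assumes "inj_on h {1..n}"
  shows "card (grid_permutations n h) = fact n"
proof -
  have "inj_on (rearrange n h) {\<pi>. \<pi> permutes {1..n}}"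
  proof (intro inj_onI, clarify)
    fix \<pi> \<tau> assume p: "\<pi> permutes {1..n}" "\<tau> permutes {1..n}"
      and e: "rearrange n h \<pi> = rearrange n h \<tau>"
    show "\<pi> = \<tau>"
    proof
      fix i show "\<pi> i = \<tau> i"
      proof (cases "i \<in> {1..n}")
        case True
        then have "h (\<pi> i) = h (\<tau> i)" using fun_cong[OF e, of i] by (simp add: rearrange_def)
        moreover have "\<pi> i \<in> {1..n}" "\<tau> i \<in> {1..n}"
          using True permutes_in_image[OF p(1), of i] permutes_in_image[OF p(2), of i] by simp_all
        ultimately show ?thesis by (rule inj_onD[OF assms])
      next
        case False
        then show ?thesis
          using permutes_not_in[OF p(1) False] permutes_not_in[OF p(2) False] by simp
      qed
    qed
  qed
  then show ?thesis
    unfolding grid_permutations_def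
    by (simp only: card_image) (rule card_permutations, simp_all)
qed

end

theory Submission imports Defs begin

text \<open>
  The law \<open>P = \<mu>\<^sup>n\<close> of the sample is exchangeable and, for almost every sample, the order statistic
  is unchanged by relabelling the observations. Hence the conditional law of the sample given the
  order statistic is the uniform law on its rearrangements, whatever \<open>\<mu>\<close> is.

  For completeness, let \<open>\<phi> = g \<circ> T\<close> have mean zero under every \<open>\<nu>\<^sup>n\<close>. Taking \<open>\<nu>\<close> with \<open>\<mu>\<close>-density
  proportional to a sum of indicators of some of the sets \<open>A\<^sub>1, \<dots>, A\<^sub>n\<close> and combining these by
  inclusion-exclusion (Ryser's formula for the permanent) shows that the integrals of \<open>\<phi>\<close> over the
  boxes \<open>A\<^bsub>\<pi>(1)\<^esub> \<times> \<dots> \<times> A\<^bsub>\<pi>(n)\<^esub>\<close> sum to zero over all permutations \<open>\<pi>\<close>. By symmetry of \<open>\<phi>\<close> they are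
  all equal, so \<open>\<phi>\<close> integrates to zero over every box.

  Two different assignments have equal cost only on a hyperplane of the sample space, so the optimal
  assignment is almost surely unique. Rearranging the sample by \<open>\<pi>\<close> turns it from \<open>\<sigma>\<close> into
  \<open>\<sigma> \<circ> \<pi>\<close> and leaves the order statistic alone, so by exchangeability all \<open>n!\<close> assignments are
  equally likely on every event determined by the order statistic.
\<close>

section \<open>Permanents, product densities and exchangeability\<close>

declare One_nat_def [simp del]

text \<open>The right-hand side is the permanent of \<open>c\<close>. Expanding the product on the
  left gives a sum over the self-maps \<open>g\<close> of \<open>A\<close> whose values avoid
  \<open>X\<close>. The alternating sum over \<open>X\<close> cancels every \<open>g\<close> that is
  not onto, and the onto self-maps of a finite set are its permutations.\<close>

lemma ryser_formula:
  fixes c :: "'a \<Rightarrow> 'a \<Rightarrow> 'b::comm_ring_1"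
  assumes A: "finite A"
  shows "(\<Sum>X\<in>Pow A. (-1) ^ card X * (\<Prod>j\<in>A. \<Sum>i\<in>A - X. c i j))
       = (\<Sum>\<pi> | \<pi> permutes A. \<Prod>j\<in>A. c (\<pi> j) j)"
proof -
  let ?G = "A \<rightarrow>\<^sub>E A"
  have fG: "finite ?G" using A by (simp add: finite_PiE)
  \<comment> \<open>That \<open>g\<close> avoids \<open>X\<close> is written as a product of
    indicators over \<open>X\<close>; the sum then runs over one index set for all \<open>X\<close>,
    and the two sums can be exchanged.\<close>
  have sub: "(\<Prod>j\<in>A. \<Sum>i\<in>A - X. c i j)
      = (\<Sum>g\<in>?G. (\<Prod>x\<in>X. of_bool (x \<notin> g ` A)) * (\<Prod>j\<in>A. c (g j) j))" if X: "X \<subseteq> A" for X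
  proof -
    have "(\<Prod>j\<in>A. \<Sum>i\<in>A - X. c i j) = (\<Sum>g\<in>A \<rightarrow>\<^sub>E (A - X). \<Prod>j\<in>A. c (g j) j)"
      using A by (subst prod_sum_PiE) auto
    also have "\<dots> = (\<Sum>g\<in>?G. of_bool (X \<inter> g ` A = {}) * (\<Prod>j\<in>A. c (g j) j))"
      by (rule sum.mono_neutral_cong_left[OF fG]) (auto simp: PiE_iff)
    also have "\<dots> = (\<Sum>g\<in>?G. (\<Prod>x\<in>X. of_bool (x \<notin> g ` A)) * (\<Prod>j\<in>A. c (g j) j))"
    proof (rule sum.cong[OF refl])
      fix g
      have "(\<Prod>x\<in>X. of_bool (x \<notin> g ` A)) = (of_bool (X \<inter> g ` A = {}) :: 'b)"
      proof (cases "X \<inter> g ` A = {}")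
        case True
        then show ?thesis by (auto intro!: prod.neutral)
      next
        case False
        then obtain x where "x \<in> X" "x \<in> g ` A" by auto
        then have "\<exists>x\<in>X. of_bool (x \<notin> g ` A) = (0::'b)" by auto
        then have "(\<Prod>x\<in>X. of_bool (x \<notin> g ` A)) = (0::'b)"
          by (rule prod_zero[OF finite_subset[OF X A]])
        with False show ?thesis by simp
      qed
      then show "of_bool (X \<inter> g ` A = {}) * (\<Prod>j\<in>A. c (g j) j)
         = (\<Prod>x\<in>X. of_bool (x \<notin> g ` A)) * (\<Prod>j\<in>A. c (g j) j)" by simp
    qed
    finally show ?thesis .
  qed
  have img: "g ` A \<subseteq> A" if "g \<in> ?G" for g using that by auto
  \<comment> \<open>Inclusion-exclusion for a fixed \<open>g\<close>: the sum is the expansion of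
    the product, over \<open>x\<close> in \<open>A\<close>, of one minus the indicator that
    \<open>g\<close> misses \<open>x\<close>.\<close>
  have alt: "(\<Sum>X\<in>Pow A. (-1) ^ card X * (\<Prod>x\<in>X. of_bool (x \<notin> g ` A)))
      = (of_bool (A \<subseteq> g ` A) :: 'b)" for g :: "'a \<Rightarrow> 'a"
  proof -
    have "(\<Sum>X\<in>Pow A. (-1) ^ card X * (\<Prod>x\<in>X. of_bool (x \<notin> g ` A)))
        = (\<Prod>x\<in>A. 1 - of_bool (x \<notin> g ` A) :: 'b)"
      by (subst prod_diff_conv_sum[OF A]) simp
    also have "\<dots> = of_bool (A \<subseteq> g ` A)"
    proof (cases "A \<subseteq> g ` A")
      case True
      then show ?thesis by (auto intro!: prod.neutral)
    next
      case False
      then show ?thesis using A by (auto intro!: prod_zero)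
    qed
    finally show ?thesis .
  qed
  have "(\<Sum>X\<in>Pow A. (-1) ^ card X * (\<Prod>j\<in>A. \<Sum>i\<in>A - X. c i j))
     = (\<Sum>X\<in>Pow A. \<Sum>g\<in>?G. (-1) ^ card X * (\<Prod>x\<in>X. of_bool (x \<notin> g ` A)) * (\<Prod>j\<in>A. c (g j) j))"
    by (intro sum.cong refl) (simp add: sub sum_distrib_left mult.assoc)
  also have "\<dots> = (\<Sum>g\<in>?G. of_bool (A \<subseteq> g ` A) * (\<Prod>j\<in>A. c (g j) j))"
    by (subst sum.swap) (simp only: sum_distrib_right[symmetric] alt)
  also have "\<dots> = (\<Sum>g\<in>{g\<in>?G. g ` A = A}. \<Prod>j\<in>A. c (g j) j)"
  proof (rule sum.mono_neutral_cong_right[OF fG])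
    show "\<forall>g\<in>?G - {g\<in>?G. g ` A = A}. of_bool (A \<subseteq> g ` A) * (\<Prod>j\<in>A. c (g j) j) = 0"
    proof
      fix g assume g: "g \<in> ?G - {g\<in>?G. g ` A = A}"
      then have "\<not> A \<subseteq> g ` A" using img[of g] by blast
      then show "of_bool (A \<subseteq> g ` A) * (\<Prod>j\<in>A. c (g j) j) = 0" by simp
    qed
  qed auto
  also have "\<dots> = (\<Sum>\<pi> | \<pi> permutes A. \<Prod>j\<in>A. c (\<pi> j) j)"
  \<comment> \<open>Elements of \<open>A \<rightarrow>\<^sub>E A\<close> are
    \<open>undefined\<close> outside \<open>A\<close>, whereas permutations are the identity there.
    The two witnesses switch between these default values.\<close>
  proof (rule sum.reindex_bij_witness
      [where i = "\<lambda>\<pi>. restrict \<pi> A" and j = "\<lambda>g i. if i \<in> A then g i else i"])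
    fix g assume g: "g \<in> {g\<in>?G. g ` A = A}"
    have "g ` A = A" using g by blast
    moreover from this have "inj_on g A" using A by (intro eq_card_imp_inj_on) simp_all
    ultimately have "bij_betw g A A" by (simp add: bij_betw_def)
    then have "bij_betw (\<lambda>i. if i \<in> A then g i else i) A A"
      by (simp cong: bij_betw_cong)
    then show "(\<lambda>i. if i \<in> A then g i else i) \<in> {\<pi>. \<pi> permutes A}"
      by (auto intro: bij_imp_permutes)
    show "restrict (\<lambda>i. if i \<in> A then g i else i) A = g"
    proof
      fix i show "restrict (\<lambda>i. if i \<in> A then g i else i) A i = g i"
        using g PiE_arb[of g A "\<lambda>_. A" i] by (cases "i \<in> A") auto
    qed
  next
    fix \<pi> assume "\<pi> \<in> {\<pi>. \<pi> permutes A}"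
    then show "restrict \<pi> A \<in> {g\<in>?G. g ` A = A}" 
      by (auto simp: permutes_image permutes_in_image)
  qed (auto simp: fun_eq_iff permutes_not_in)
  finally show ?thesis .
qed

text \<open>The density is a product of one-coordinate factors, so its integral over a box splits
  into the masses of the sides; agreement on boxes identifies the product measure.\<close>

lemma PiM_density:
  assumes I: "finite I"
    and M: "\<And>i. sigma_finite_measure (M i)"
    and f [measurable]: "\<And>i. f i \<in> borel_measurable (M i)"
    and D: "\<And>i. sigma_finite_measure (density (M i) (f i))"
  shows "PiM I (\<lambda>i. density (M i) (f i)) = density (PiM I M) (\<lambda>x. \<Prod>i\<in>I. f i (x i))"
proof -
  interpret M: product_sigma_finite M by (simp add: product_sigma_finite_def M)
  interpret D: product_sigma_finite "\<lambda>i. density (M i) (f i)" by (simp add: product_sigma_finite_def D)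
  have sets_eq: "sets (PiM I (\<lambda>i. density (M i) (f i))) = sets (PiM I M)"
    by (rule sets_PiM_cong) auto
  show ?thesis
  proof (rule D.PiM_eqI[OF I, symmetric])
    fix A assume "\<And>i. i \<in> I \<Longrightarrow> A i \<in> sets (density (M i) (f i))"
    then have A [measurable]: "A i \<in> sets (M i)" if "i \<in> I" for i using that by simp
    have [measurable]: "(\<lambda>x. \<Prod>i\<in>I. f i (x i)) \<in> borel_measurable (PiM I M)"
      by (intro borel_measurable_prod_ennreal measurable_compose[OF measurable_component_singleton]) auto
    have "emeasure (density (PiM I M) (\<lambda>x. \<Prod>i\<in>I. f i (x i))) (Pi\<^sub>E I A)
        = (\<integral>\<^sup>+x. (\<Prod>i\<in>I. f i (x i)) * indicator (Pi\<^sub>E I A) x \<partial>PiM I M)"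
      using I A by (intro emeasure_density sets_PiM_I_finite) auto
    also have "\<dots> = (\<integral>\<^sup>+x. (\<Prod>i\<in>I. f i (x i) * indicator (A i) (x i)) \<partial>PiM I M)"
    proof (rule nn_integral_cong)
      fix x assume "x \<in> space (PiM I M)"
      then have "indicator (Pi\<^sub>E I A) x = (\<Prod>i\<in>I. indicator (A i) (x i) :: ennreal)"
        using I by (auto simp: indicator_def space_PiM PiE_iff prod_zero_iff)
      then show "(\<Prod>i\<in>I. f i (x i)) * indicator (Pi\<^sub>E I A) x
         = (\<Prod>i\<in>I. f i (x i) * indicator (A i) (x i))" by (simp add: prod.distrib)
    qed
    also have "\<dots> = (\<Prod>i\<in>I. \<integral>\<^sup>+x. f i x * indicator (A i) x \<partial>M i)"
      using I A by (intro M.product_nn_integral_prod) auto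
    also have "\<dots> = (\<Prod>i\<in>I. emeasure (density (M i) (f i)) (A i))"
      by (intro prod.cong refl) (simp add: emeasure_density A)
    finally show "emeasure (density (PiM I M) (\<lambda>x. \<Prod>i\<in>I. f i (x i))) (Pi\<^sub>E I A)
      = (\<Prod>i\<in>I. emeasure (density (M i) (f i)) (A i))" .
  qed (simp add: sets_eq)
qed

text \<open>Carries what holds for Lebesgue-almost every sample over to every law of the family: a
  Radon-Nikodym density of one coordinate yields a product density of the sample, and passing to a
  density keeps null sets null.\<close>

lemma AE_PiM_absolutely_continuous:
  assumes I: "finite I"
    and \<nu>: "sigma_finite_measure \<nu>"
    and \<mu>: "sigma_finite_measure \<mu>" "sets \<mu> = sets \<nu>" "absolutely_continuous \<nu> \<mu>"
    and Q: "AE x in PiM I (\<lambda>_. \<nu>). Q x"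
  shows "AE x in PiM I (\<lambda>_. \<mu>). Q x"
proof -
  obtain f where f [measurable]: "f \<in> borel_measurable \<nu>" and eq: "density \<nu> f = \<mu>"
    using sigma_finite_measure.Radon_Nikodym[OF \<nu> \<mu>(3,2)] by auto
  have "PiM I (\<lambda>_. \<mu>) = density (PiM I (\<lambda>_. \<nu>)) (\<lambda>x. \<Prod>i\<in>I. f (x i))"
    using PiM_density[of I "\<lambda>_. \<nu>" "\<lambda>_. f"] I \<nu> \<mu>(1) by (simp add: eq)
  moreover have "(\<lambda>x. \<Prod>i\<in>I. f (x i)) \<in> borel_measurable (PiM I (\<lambda>_. \<nu>))"
    by (intro borel_measurable_prod_ennreal measurable_compose[OF measurable_component_singleton]) auto
  ultimately show ?thesis using Q by (simp only: AE_density) (auto elim: eventually_mono)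
qed

lemma finite_perms: "finite {\<pi>. \<pi> permutes {1..n::nat}}"
  by (rule finite_permutations) simp

lemma measurable_rearrange [measurable]:
  assumes "\<pi> permutes {1..n}"
  shows "(\<lambda>x. rearrange n x \<pi>) \<in> PiM {1..n} (\<lambda>_. N) \<rightarrow>\<^sub>M PiM {1..n} (\<lambda>_. N)"
  unfolding rearrange_def
  using permutes_in_image[OF assms] by (intro measurable_restrict measurable_component_singleton) simp

lemma rearrange_rearrange:
  assumes "\<pi> permutes {1..n}"
  shows "rearrange n (rearrange n x \<tau>) \<pi> = rearrange n x (\<tau> \<circ> \<pi>)"
  using permutes_in_image[OF assms] by (auto simp: rearrange_def fun_eq_iff)

text \<open>Exchangeability of an i.i.d. sample: permuting the coordinates only reindexes a product
  of identical factors.\<close>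

lemma distr_PiM_rearrange:
  assumes "prob_space \<mu>" "\<pi> permutes {1..n}"
  shows "distr (PiM {1..n} (\<lambda>_. \<mu>)) (PiM {1..n} (\<lambda>_. \<mu>)) (\<lambda>x. rearrange n x \<pi>) = PiM {1..n} (\<lambda>_. \<mu>)"
  unfolding rearrange_def
  using assms
  by (intro distr_PiM_reindex[of "{1..n}" "\<lambda>_. \<mu>" \<pi> "{1..n}"])
    (auto simp: permutes_inj_on permutes_in_image simp del: atLeastAtMost_iff)

section \<open>Sufficiency\<close>

text \<open>\<open>T x\<close> lies in the orbit of \<open>x\<close> under rearrangement, and
  composing with a fixed permutation permutes the summands. Averages over the orbit can thus be
  computed from \<open>x\<close> as well as from \<open>T x\<close>.\<close>

lemma sum_rearrange_order_statistic:
  assumes T: "order_statistic n T" and x: "x \<in> space (sample_space n)"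
  shows "(\<Sum>\<pi> | \<pi> permutes {1..n}. f (rearrange n (T x) \<pi>))
       = (\<Sum>\<pi> | \<pi> permutes {1..n}. f (rearrange n x \<pi>))"
proof -
  obtain \<tau> where \<tau>: "\<tau> permutes {1..n}" "T x = rearrange n x \<tau>"
    using T x unfolding order_statistic_def by blast
  have "(\<Sum>\<pi> | \<pi> permutes {1..n}. f (rearrange n (T x) \<pi>))
      = (\<Sum>\<pi> | \<pi> permutes {1..n}. f (rearrange n x (\<tau> \<circ> \<pi>)))"
    by (intro sum.cong refl) (simp add: \<tau>(2) rearrange_rearrange)
  also have "\<dots> = (\<Sum>\<pi> | \<pi> permutes {1..n}. f (rearrange n x \<pi>))"
    using \<tau>(1) by (rule setum_permutations_compose_left[symmetric])
  finally show ?thesis .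
qed

text \<open>The conditional law of the sample given that the order statistic equals
  \<open>t\<close>: the entries of \<open>t\<close> in uniformly random order. No \<mu> occurs in
  it, as sufficiency demands.\<close>

definition shuffle_kernel :: "nat \<Rightarrow> (nat \<Rightarrow> real ^ 'd) \<Rightarrow> (nat \<Rightarrow> real ^ 'd) measure" where
  "shuffle_kernel n t =
     distr (uniform_count_measure {\<pi>. \<pi> permutes {1..n}}) (sample_space n) (rearrange n t)"

lemma rearrange_in_space:
  assumes "t \<in> space (PiM {1..n} (\<lambda>_. N))" "\<pi> permutes {1..n}"
  shows "rearrange n t \<pi> \<in> space (PiM {1..n} (\<lambda>_. N))"
  using measurable_space[OF measurable_rearrange[OF assms(2)] assms(1)] .

text \<open>The kernel is the image of a constant measure under a jointly measurable map; since
  there are finitely many permutations, joint measurability reduces to measurability in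
  \<open>t\<close> for each fixed permutation.\<close>

lemma shuffle_kernel_measurable:
  "shuffle_kernel n \<in> sample_space n \<rightarrow>\<^sub>M prob_algebra (sample_space n)"
proof -
  let ?\<Pi> = "{\<pi>. \<pi> permutes {1..n}}"
  have fin: "finite ?\<Pi>" by (rule finite_perms)
  have ne: "?\<Pi> \<noteq> {}" using permutes_id[of "{1..n}"] by blast
  have "(\<lambda>t. distr (uniform_count_measure ?\<Pi>) (sample_space n) (rearrange n t))
     \<in> sample_space n \<rightarrow>\<^sub>M prob_algebra (sample_space n :: (nat \<Rightarrow> real ^ 'd) measure)"
  proof (rule measurable_distr_prob_space2)
    show "(\<lambda>t. uniform_count_measure ?\<Pi>) \<in> sample_space n \<rightarrow>\<^sub>M prob_algebra (count_space ?\<Pi>)"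
      using fin ne
      by (intro measurable_const)
        (simp add: space_prob_algebra prob_space_uniform_count_measure sets_uniform_count_measure)
    show "(\<lambda>(t, \<pi>). rearrange n t \<pi>) \<in> sample_space n \<Otimes>\<^sub>M count_space ?\<Pi> \<rightarrow>\<^sub>M sample_space n"
      unfolding split_beta
      by (rule measurable_compose_countable'[where f = "\<lambda>\<pi> p. rearrange n (fst p) \<pi>" and I = ?\<Pi>])
        (use fin in \<open>auto simp: countable_finite intro: measurable_compose[OF measurable_fst measurable_rearrange]\<close>)
  qed
  then show ?thesis by (simp add: shuffle_kernel_def[abs_def])
qed

lemma measure_shuffle_kernel:
  assumes t: "t \<in> space (sample_space n)" and A: "A \<in> sets (sample_space n)"
  shows "measure (shuffle_kernel n t) A
       = (\<Sum>\<pi> | \<pi> permutes {1..n}. indicator A (rearrange n t \<pi>)) / fact n"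
proof -
  let ?\<Pi> = "{\<pi>. \<pi> permutes {1..n}}"
  have fin: "finite ?\<Pi>" by (rule finite_perms)
  have m: "rearrange n t \<in> uniform_count_measure ?\<Pi> \<rightarrow>\<^sub>M sample_space n"
    by (subst measurable_cong_sets[OF sets_uniform_count_measure_count_space refl])
      (use t in \<open>auto intro: rearrange_in_space\<close>)
  have "measure (shuffle_kernel n t) A = real (card {\<pi>\<in>?\<Pi>. rearrange n t \<pi> \<in> A}) / real (card ?\<Pi>)"
    unfolding shuffle_kernel_def using fin A
    by (subst measure_distr[OF m A], subst measure_uniform_count_measure)
      (auto simp: space_uniform_count_measure intro!: arg_cong2[where f = "(/)"] arg_cong[where f = card])
  also have "card ?\<Pi> = fact n" by (rule card_permutations) simp_all
  also have "real (card {\<pi>\<in>?\<Pi>. rearrange n t \<pi> \<in> A}) = (\<Sum>\<pi>\<in>?\<Pi>. indicator A (rearrange n t \<pi>))"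
    using fin by (simp add: indicator_def sum.If_cases Int_def)
  finally show ?thesis by simp
qed

locale ac_sample =
  fixes \<mu> :: "(real ^ 'd) measure" and n :: nat
  assumes ac: "\<mu> \<in> ac_probability_measures"
begin

abbreviation P :: "(nat \<Rightarrow> real ^ 'd) measure" where "P \<equiv> PiM {1..n} (\<lambda>_. \<mu>)"

lemma prob_\<mu>: "prob_space \<mu>" and sets_\<mu> [measurable_cong]: "sets \<mu> = sets borel"
  and ac_\<mu>: "absolutely_continuous lborel \<mu>"
  using ac by (simp_all add: ac_probability_measures_def)

lemma sets_P [measurable_cong]: "sets P = sets (sample_space n)"
  by (intro sets_PiM_cong refl sets_\<mu>)

lemma space_P: "space P = space (sample_space n)"
  by (rule sets_eq_imp_space_eq[OF sets_P])

lemma prob_P: "prob_space P"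
  by (intro prob_space_PiM prob_\<mu>)

sublocale P: prob_space P by (rule prob_P)

lemma AE_P_of_AE_lborel:
  assumes "AE x in PiM {1..n} (\<lambda>_. lborel). Q x"
  shows "AE x in P. Q x"
proof (rule AE_PiM_absolutely_continuous[OF _ _ _ _ ac_\<mu> assms])
  show "sigma_finite_measure \<mu>" using prob_\<mu> by (simp add: prob_space_imp_sigma_finite)
qed (simp_all add: sets_\<mu> sigma_finite_lborel)

lemma AE_order_statistic_rearrange:
  assumes "order_statistic n T"
  shows "AE x in P. \<forall>\<pi>. \<pi> permutes {1..n} \<longrightarrow> T (rearrange n x \<pi>) = T x"
  using assms unfolding order_statistic_def by (blast intro: AE_P_of_AE_lborel)

lemma integral_rearrange:
  fixes f :: "(nat \<Rightarrow> real ^ 'd) \<Rightarrow> real"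
  assumes "\<pi> permutes {1..n}" and f: "f \<in> borel_measurable (sample_space n)"
  shows "(\<integral>x. f (rearrange n x \<pi>) \<partial>P) = (\<integral>x. f x \<partial>P)"
proof -
  have "f \<in> borel_measurable P" using f by (subst measurable_cong_sets[OF sets_P refl])
  then have "(\<integral>x. f x \<partial>distr P P (\<lambda>x. rearrange n x \<pi>)) = (\<integral>x. f (rearrange n x \<pi>) \<partial>P)"
    by (rule integral_distr[OF measurable_rearrange[OF assms(1)]])
  then show ?thesis by (simp only: distr_PiM_rearrange[OF prob_\<mu> assms(1)])
qed

text \<open>Checks the defining property of conditional expectation: the kernel value is a function
  of \<open>T x\<close>, and on each event \<open>B\<close> determined by \<open>T\<close> it has
  the same integral as the indicator of \<open>A\<close>. Each of the \<open>n!\<close> terms of the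
  average contributes the probability of \<open>B \<inter> A\<close>, because \<open>B\<close> is
  almost surely invariant under rearrangement and \<open>P\<close> is exchangeable.\<close>

lemma order_statistic_cond_exp:
  assumes T: "order_statistic n T" and A [measurable]: "A \<in> sets (sample_space n)"
  shows "AE x in P. real_cond_exp P (vimage_algebra (space (sample_space n)) T (sample_space n))
           (indicator A) x = measure (shuffle_kernel n (T x)) A"
proof -
  let ?S = "sample_space n :: (nat \<Rightarrow> real ^ 'd) measure"
  let ?F = "vimage_algebra (space ?S) T ?S"
  let ?\<Pi> = "{\<pi>. \<pi> permutes {1..n}}"
  define k :: "(nat \<Rightarrow> real ^ 'd) \<Rightarrow> real"
    where "k = (\<lambda>t. (\<Sum>\<pi>\<in>?\<Pi>. indicator A (rearrange n t \<pi>)) / fact n)"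
  have fin: "finite ?\<Pi>" by (rule finite_perms)
  have T_meas [measurable]: "T \<in> ?S \<rightarrow>\<^sub>M ?S" using T by (simp add: order_statistic_def)
  have T_sp: "T \<in> space ?S \<rightarrow> space ?S" using measurable_space[OF T_meas] by auto
  have indA: "(\<lambda>t. indicator A (rearrange n t \<pi>) :: real) \<in> borel_measurable ?S"
    if "\<pi> permutes {1..n}" for \<pi>
    using measurable_rearrange[OF that] by measurable
  have k_meas [measurable]: "k \<in> borel_measurable ?S"
    unfolding k_def using indA by (intro borel_measurable_divide borel_measurable_sum) auto
  \<comment> \<open>Measurability with respect to \<open>?F\<close> is visible in
    \<open>k (T x)\<close>, whereas exchangeability applies to \<open>k x\<close>; the proof needs
    both forms.\<close>
  have k_T: "k (T x) = k x" if "x \<in> space ?S" for x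
    unfolding k_def using sum_rearrange_order_statistic[OF T that] by simp
  have sets_F: "sets ?F = {T -` C \<inter> space ?S | C. C \<in> sets ?S}"
    using T_sp by (rule sets_vimage_algebra2)
  have sub: "subalgebra P ?F"
    unfolding subalgebra_def space_P sets_P sets_F using T_meas by (auto intro: measurable_sets)
  interpret finite_measure_subalgebra P ?F
    using sub by unfold_locales
  have bound: "norm (k t) \<le> 1" for t
  proof -
    have "(\<Sum>\<pi>\<in>?\<Pi>. indicator A (rearrange n t \<pi>) :: real) \<le> (\<Sum>\<pi>\<in>?\<Pi>. 1)"
      by (rule sum_mono) (simp add: indicator_le_1)
    also have "\<dots> = fact n" using card_permutations[of "{1..n}" n] by simp
    finally show ?thesis by (simp add: k_def sum_nonneg)
  qed
  have "AE x in P. real_cond_exp P ?F (indicator A) x = k (T x)"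
  proof (rule real_cond_exp_charact)
    show "integrable P (indicator A :: _ \<Rightarrow> real)"
      by (rule P.integrable_const_bound[where B = 1]) (auto simp: indicator_def)
    show "integrable P (\<lambda>x. k (T x))"
      by (rule P.integrable_const_bound[where B = 1]) (use bound in auto)
    show "(\<lambda>x. k (T x)) \<in> borel_measurable ?F"
      by (rule measurable_compose[OF measurable_vimage_algebra1[OF T_sp] k_meas])
    fix B assume "B \<in> sets ?F"
    then obtain C where C [measurable]: "C \<in> sets ?S" and B: "B = T -` C \<inter> space ?S"
      unfolding sets_F by blast
    have [measurable]: "B \<in> sets ?S" unfolding B by measurable
    \<comment> \<open>First the rearrangement is inserted into the indicator of \<open>B\<close>,
      which changes it only on a null set; then exchangeability removes it from both factors at
      once.\<close>
    have *: "(\<integral>x. indicator B x * indicator A (rearrange n x \<pi>) \<partial>P)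
        = (\<integral>x. (indicator B x * indicator A x :: real) \<partial>P)" if \<pi>: "\<pi> permutes {1..n}" for \<pi>
    proof -
      note measurable_rearrange[OF \<pi>, measurable]
      have "(\<integral>x. indicator B x * indicator A (rearrange n x \<pi>) \<partial>P)
          = (\<integral>x. (indicator B (rearrange n x \<pi>) * indicator A (rearrange n x \<pi>) :: real) \<partial>P)"
      proof (rule integral_cong_AE)
        show "AE x in P. indicator B x * indicator A (rearrange n x \<pi>)
           = (indicator B (rearrange n x \<pi>) * indicator A (rearrange n x \<pi>) :: real)"
          using AE_order_statistic_rearrange[OF T] AE_space
        proof eventually_elim
          case (elim x)
          have "x \<in> space ?S" using elim(2) by (simp only: space_P)
          then have "x \<in> B \<longleftrightarrow> rearrange n x \<pi> \<in> B"
            using elim(1) \<pi> rearrange_in_space[of x n borel \<pi>] unfolding B by auto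
          then show ?case by (simp add: indicator_def)
        qed
      qed measurable
      also have "\<dots> = (\<integral>x. (indicator B x * indicator A x :: real) \<partial>P)"
        by (rule integral_rearrange[OF \<pi>]) measurable
      finally show ?thesis .
    qed
    have "(\<integral>x\<in>B. k (T x) \<partial>P)
       = (\<integral>x. (\<Sum>\<pi>\<in>?\<Pi>. indicator B x * indicator A (rearrange n x \<pi>)) / fact n \<partial>P)"
      unfolding set_lebesgue_integral_def
      by (rule Bochner_Integration.integral_cong[OF refl], subst k_T)
        (simp_all only: space_P, simp_all add: k_def sum_distrib_left)
    also have "\<dots> = (\<integral>x. (\<Sum>\<pi>\<in>?\<Pi>. indicator B x * indicator A (rearrange n x \<pi>)) \<partial>P) / fact n"
      by simp
    also have "(\<integral>x. (\<Sum>\<pi>\<in>?\<Pi>. indicator B x * indicator A (rearrange n x \<pi>)) \<partial>P)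
       = (\<Sum>\<pi>\<in>?\<Pi>. \<integral>x. (indicator B x * indicator A (rearrange n x \<pi>) :: real) \<partial>P)"
    proof (rule Bochner_Integration.integral_sum)
      fix \<pi> assume \<pi>: "\<pi> \<in> ?\<Pi>"
      then have [measurable]: "(\<lambda>x. indicator A (rearrange n x \<pi>) :: real) \<in> borel_measurable ?S"
        using indA by auto
      show "integrable P (\<lambda>x. indicator B x * indicator A (rearrange n x \<pi>) :: real)"
      proof (rule P.integrable_const_bound[where B = 1])
        show "AE x in P. norm (indicator B x * indicator A (rearrange n x \<pi>) :: real) \<le> 1"
          by (simp add: indicator_def)
      qed measurable
    qed
    also have "\<dots> / fact n = (\<integral>x. (indicator B x * indicator A x :: real) \<partial>P)"
      using card_permutations[of "{1..n}" n] by (simp add: *)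
    finally show "(\<integral>x\<in>B. indicator A x \<partial>P) = (\<integral>x\<in>B. k (T x) \<partial>P)"
      by (simp add: set_lebesgue_integral_def)
  qed
  then show ?thesis using AE_space
  proof eventually_elim
    case (elim x)
    then have "T x \<in> space ?S" using T_sp unfolding space_P by auto
    with elim show ?case by (simp only: measure_shuffle_kernel[OF _ A] k_def)
  qed
qed

end

lemma order_statistic_sufficient:
  assumes T: "order_statistic n (T :: (nat \<Rightarrow> real ^ 'd) \<Rightarrow> _)"
  shows "sufficient_statistic (iid_laws n) (sample_space n) (sample_space n) T"
  unfolding sufficient_statistic_def
proof (intro conjI bexI ballI)
  show "T \<in> sample_space n \<rightarrow>\<^sub>M sample_space n" using T by (simp add: order_statistic_def)
  show "shuffle_kernel n \<in> sample_space n \<rightarrow>\<^sub>M prob_algebra (sample_space n :: (nat \<Rightarrow> real ^ 'd) measure)"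
    by (rule shuffle_kernel_measurable)
  fix P :: "(nat \<Rightarrow> real ^ 'd) measure" and A :: "(nat \<Rightarrow> real ^ 'd) set"
  assume "P \<in> iid_laws n" and A: "A \<in> sets (sample_space n)"
  then obtain \<mu> where \<mu>: "\<mu> \<in> ac_probability_measures" "P = PiM {1..n} (\<lambda>_. \<mu>)"
    by (auto simp: iid_laws_def)
  interpret ac_sample \<mu> n by unfold_locales (rule \<mu>)
  show "AE x in P. real_cond_exp P (vimage_algebra (space (sample_space n)) T (sample_space n))
           (indicator A) x = measure (shuffle_kernel n (T x)) A"
    unfolding \<mu>(2) by (rule order_statistic_cond_exp[OF T A])
qed

section \<open>Completeness\<close>

text \<open>Produces the reweighted laws on which the mean-zero hypothesis of completeness is
  tested.\<close>

lemma prob_density_normalized: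
  fixes w :: "'a \<Rightarrow> real"
  assumes w: "integrable M w" "\<And>x. 0 \<le> w x" and m: "(\<integral>x. w x \<partial>M) = m" "m > 0"
  shows "prob_space (density M (\<lambda>x. ennreal (w x / m)))"
proof
  have "emeasure (density M (\<lambda>x. ennreal (w x / m))) (space (density M (\<lambda>x. ennreal (w x / m))))
      = (\<integral>\<^sup>+x. ennreal (w x / m) \<partial>M)"
    using w by (simp add: emeasure_density cong: nn_integral_cong)
  also have "\<dots> = ennreal (\<integral>x. w x / m \<partial>M)"
    using w m by (intro nn_integral_eq_integral) auto
  also have "\<dots> = 1" using m by simp
  finally show "emeasure (density M (\<lambda>x. ennreal (w x / m)))
      (space (density M (\<lambda>x. ennreal (w x / m)))) = 1" .
qed

text \<open>Reweighting stays within the family: Lebesgue null sets are null for \<mu>, hence for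
  any measure with a density with respect to \<mu>.\<close>

lemma (in ac_sample) density_ac:
  assumes f: "f \<in> borel_measurable \<mu>" and "prob_space (density \<mu> f)"
  shows "density \<mu> f \<in> ac_probability_measures"
  using assms ac_\<mu> absolutely_continuousI_density[OF f]
  by (auto simp: ac_probability_measures_def sets_\<mu> absolutely_continuous_def)

text \<open>The hypothesis is applied to the law with \<mu>-density \<open>w / m\<close>, where
  \<open>m\<close> is the mean of \<open>w\<close>. The sample then has the product of the
  \<open>w (x j) / m\<close> as density with respect to \<open>P\<close>, and the factor
  \<open>m ^ n\<close> can be cleared.\<close>

lemma (in ac_sample) integral_weighted_eq_0:
  fixes \<phi> :: "(nat \<Rightarrow> real ^ 'd) \<Rightarrow> real" and w :: "real ^ 'd \<Rightarrow> real"
  assumes \<phi> [measurable]: "\<phi> \<in> borel_measurable (sample_space n)"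
    and zero: "\<And>\<nu>. \<nu> \<in> ac_probability_measures \<Longrightarrow> (\<integral>x. \<phi> x \<partial>PiM {1..n} (\<lambda>_. \<nu>)) = 0"
    and w [measurable]: "w \<in> borel_measurable borel" and w0: "\<And>x. 0 \<le> w x" and wB: "\<And>x. w x \<le> B"
  shows "(\<integral>x. \<phi> x * (\<Prod>j\<in>{1..n}. w (x j)) \<partial>P) = 0"
proof -
  interpret \<mu>: prob_space \<mu> by (rule prob_\<mu>)
  define m where "m = (\<integral>x. w x \<partial>\<mu>)"
  have w_int: "integrable \<mu> w"
    by (rule \<mu>.integrable_const_bound[where B = B]) (use w0 wB in auto)
  have "m \<ge> 0" unfolding m_def using w0 by (intro integral_nonneg_AE) auto
  \<comment> \<open>Normalising requires \<open>m > 0\<close>. If \<open>m = 0\<close>, then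
    \<open>w\<close> vanishes almost everywhere, and for \<open>n > 0\<close> coordinate 1 makes the
    product zero. For \<open>n = 0\<close> the product is empty and the hypothesis at \<mu> itself
    suffices.\<close>
  then consider "n = 0" | "n > 0" "m = 0" | "m > 0" by fastforce
  then show ?thesis
  proof cases
    case 1
    then show ?thesis using zero[OF ac] by simp
  next
    case 2
    then have "AE x in \<mu>. w x = 0"
      using integral_nonneg_eq_0_iff_AE[OF w_int] w0 by (simp add: m_def)
    then have "AE x in P. w (x 1) = 0"
      using 2 by (intro AE_PiM_component[where P = "\<lambda>y. w y = 0"] prob_\<mu>) auto
    then have "AE x in P. \<phi> x * (\<Prod>j\<in>{1..n}. w (x j)) = 0"
    proof eventually_elim
      case (elim x)
      then have "\<exists>j\<in>{1..n}. w (x j) = 0" using 2 by (intro bexI[of _ 1]) auto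
      then show ?case by (simp add: prod_zero)
    qed
    then show ?thesis by (rule integral_eq_zero_AE)
  next
    case 3
    let ?\<nu> = "density \<mu> (\<lambda>x. ennreal (w x / m))"
    have prob_\<nu>: "prob_space ?\<nu>"
      using w_int w0 m_def 3 by (intro prob_density_normalized) auto
    have "?\<nu> \<in> ac_probability_measures" by (intro density_ac prob_\<nu>) measurable
    then have "(\<integral>x. \<phi> x \<partial>PiM {1..n} (\<lambda>_. ?\<nu>)) = 0" by (rule zero)
    also have "PiM {1..n} (\<lambda>_. ?\<nu>) = density P (\<lambda>x. \<Prod>j\<in>{1..n}. ennreal (w (x j) / m))"
      using prob_\<nu> prob_\<mu>
      by (intro PiM_density) (auto simp: prob_space_imp_sigma_finite)
    also have "\<dots> = density P (\<lambda>x. ennreal (\<Prod>j\<in>{1..n}. w (x j) / m))"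
      using w0 3 by (simp add: prod_ennreal)
    finally have "0 = (\<integral>x. \<phi> x \<partial>density P (\<lambda>x. ennreal (\<Prod>j\<in>{1..n}. w (x j) / m)))" by simp
    also have "\<dots> = (\<integral>x. (\<Prod>j\<in>{1..n}. w (x j) / m) * \<phi> x \<partial>P)"
      by (rule integral_real_density) (use w0 3 in \<open>auto intro!: prod_nonneg\<close>)
    also have "\<dots> = (\<integral>x. \<phi> x * (\<Prod>j\<in>{1..n}. w (x j)) / m ^ n \<partial>P)"
      by (simp add: prod_dividef mult.commute)
    finally show ?thesis using 3 by simp
  qed
qed

text \<open>Ryser's formula writes the symmetrised indicator of a box as a signed sum of products
  with one common weight \<open>?w X\<close> for all coordinates, to which
  \<open>integral_weighted_eq_0\<close> applies. The symmetry of \<open>\<phi>\<close> then makes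
  the integrals over all permuted boxes equal to the one sought.\<close>

lemma (in ac_sample) integral_box_eq_0:
  fixes \<phi> :: "(nat \<Rightarrow> real ^ 'd) \<Rightarrow> real"
  assumes \<phi> [measurable]: "\<phi> \<in> borel_measurable (sample_space n)"
    and \<phi>_int: "integrable P \<phi>"
    and zero: "\<And>\<nu>. \<nu> \<in> ac_probability_measures \<Longrightarrow> (\<integral>x. \<phi> x \<partial>PiM {1..n} (\<lambda>_. \<nu>)) = 0"
    and sym: "AE x in P. \<forall>\<pi>. \<pi> permutes {1..n} \<longrightarrow> \<phi> (rearrange n x \<pi>) = \<phi> x"
    and A: "\<And>i. i \<in> {1..n} \<Longrightarrow> A i \<in> sets borel"
  shows "(\<integral>x. \<phi> x * (\<Prod>j\<in>{1..n}. indicator (A j) (x j)) \<partial>P) = 0"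
proof -
  let ?I = "{1..n}" and ?\<Pi> = "{\<pi>. \<pi> permutes {1..n}}"
  let ?w = "\<lambda>X y. \<Sum>i\<in>?I - X. indicator (A i) y :: real"
  note A [measurable]
  have int: "integrable P (\<lambda>x. \<phi> x * f x)"
    if [measurable]: "f \<in> borel_measurable (sample_space n)" and "\<And>x. \<bar>f x\<bar> \<le> B" for f :: "_ \<Rightarrow> real" and B
  proof (rule Bochner_Integration.integrable_bound)
    show "integrable P (\<lambda>x. B * \<phi> x)" using \<phi>_int by simp
    show "AE x in P. norm (\<phi> x * f x) \<le> norm (B * \<phi> x)"
    proof (rule AE_I2)
      fix x
      have "\<bar>\<phi> x\<bar> * \<bar>f x\<bar> \<le> \<bar>\<phi> x\<bar> * \<bar>B\<bar>"
        by (intro mult_left_mono order_trans[OF that(2) abs_ge_self]) simp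
      then show "norm (\<phi> x * f x) \<le> norm (B * \<phi> x)" by (simp add: abs_mult mult.commute)
    qed
  qed measurable
  have w_meas [measurable]: "?w X \<in> borel_measurable borel" for X
    by (intro borel_measurable_sum borel_measurable_indicator) (simp add: A)
  have w0: "0 \<le> ?w X y" for X y by (simp add: sum_nonneg)
  have wn: "?w X y \<le> real n" for X y
  proof -
    have "?w X y \<le> real (card (?I - X))" by (rule order_trans[OF sum_mono[where g = "\<lambda>_. 1"]]) (simp_all add: indicator_le_1)
    also have "card (?I - X) \<le> card ?I" by (rule card_mono) auto
    finally show ?thesis by simp
  qed
  \<comment> \<open>Permuting the sides of the box by \<open>\<pi>\<close> amounts to rearranging
    the sample by its inverse; \<open>\<phi>\<close> almost surely does not notice this, and
    \<open>P\<close> is exchangeable.\<close>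
  have sym_int: "(\<integral>x. \<phi> x * (\<Prod>j\<in>?I. indicator (A (\<pi> j)) (x j)) \<partial>P)
      = (\<integral>x. \<phi> x * (\<Prod>j\<in>?I. indicator (A j) (x j)) \<partial>P)" if \<pi>: "\<pi> permutes ?I" for \<pi>
  proof -
    have \<pi>i: "inv \<pi> permutes ?I" using \<pi> by (rule permutes_inv)
    have A\<pi>: "A (\<pi> j) \<in> sets borel" if "j \<in> ?I" for j using A that permutes_in_image[OF \<pi>] by blast
    note measurable_rearrange[OF \<pi>i, measurable]
    have eq: "(\<Prod>j\<in>?I. indicator (A (\<pi> j)) (x j))
       = (\<Prod>j\<in>?I. indicator (A j) (rearrange n x (inv \<pi>) j) :: real)" for x :: "nat \<Rightarrow> real ^ 'd"
    proof -
      have "(\<Prod>j\<in>?I. indicator (A j) (rearrange n x (inv \<pi>) j) :: real)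
         = (\<Prod>j\<in>?I. indicator (A (\<pi> j)) (rearrange n x (inv \<pi>) (\<pi> j)))"
        using prod.permute[OF \<pi>] by (simp add: comp_def)
      also have "\<dots> = (\<Prod>j\<in>?I. indicator (A (\<pi> j)) (x j))"
        using permutes_in_image[OF \<pi>] permutes_inverses(2)[OF \<pi>]
        by (intro prod.cong refl) (simp add: rearrange_def del: atLeastAtMost_iff)
      finally show ?thesis by simp
    qed
    have "(\<integral>x. \<phi> x * (\<Prod>j\<in>?I. indicator (A (\<pi> j)) (x j)) \<partial>P)
       = (\<integral>x. \<phi> (rearrange n x (inv \<pi>)) * (\<Prod>j\<in>?I. indicator (A j) (rearrange n x (inv \<pi>) j)) \<partial>P)"
    proof (rule integral_cong_AE)
      show "AE x in P. \<phi> x * (\<Prod>j\<in>?I. indicator (A (\<pi> j)) (x j))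
        = \<phi> (rearrange n x (inv \<pi>)) * (\<Prod>j\<in>?I. indicator (A j) (rearrange n x (inv \<pi>) j))"
        using sym by eventually_elim (simp add: eq \<pi>i)
    qed (use A\<pi> in measurable)
    also have "\<dots> = (\<integral>x. \<phi> x * (\<Prod>j\<in>?I. indicator (A j) (x j)) \<partial>P)"
      by (rule integral_rearrange[OF \<pi>i, where f = "\<lambda>x. \<phi> x * (\<Prod>j\<in>?I. indicator (A j) (x j))"]) measurable
    finally show ?thesis .
  qed
  \<comment> \<open>Every summand vanishes separately. The sum is still formed, with Ryser's signs,
    so that it can be moved under the integral and evaluated there.\<close>
  have "0 = (\<Sum>X\<in>Pow ?I. (-1) ^ card X * (\<integral>x. \<phi> x * (\<Prod>j\<in>?I. ?w X (x j)) \<partial>P))"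
    by (simp only: integral_weighted_eq_0[OF \<phi> zero w_meas w0 wn] mult_zero_right sum.neutral_const)
  also have "\<dots> = (\<integral>x. (\<Sum>X\<in>Pow ?I. (-1) ^ card X * (\<phi> x * (\<Prod>j\<in>?I. ?w X (x j)))) \<partial>P)"
  proof (subst Bochner_Integration.integral_sum)
    fix X
    have "\<bar>\<Prod>j\<in>?I. ?w X (x j)\<bar> \<le> real n ^ n" for x :: "nat \<Rightarrow> real ^ 'd"
    proof -
      have "(\<Prod>j\<in>?I. ?w X (x j)) \<le> (\<Prod>j\<in>?I. real n)"
        by (intro prod_mono) (use w0 wn in auto)
      then show ?thesis using w0 by (simp add: abs_of_nonneg prod_nonneg)
    qed
    then have "integrable P (\<lambda>x. \<phi> x * (\<Prod>j\<in>?I. ?w X (x j)))"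
      by (rule int[rotated]) measurable
    then show "integrable P (\<lambda>x. (-1) ^ card X * (\<phi> x * (\<Prod>j\<in>?I. ?w X (x j))))" by simp
  qed simp
  also have "\<dots> = (\<integral>x. \<phi> x * (\<Sum>X\<in>Pow ?I. (-1) ^ card X * (\<Prod>j\<in>?I. ?w X (x j))) \<partial>P)"
    by (simp add: sum_distrib_left mult.left_commute)
  \<comment> \<open>Ryser's formula is used for each \<open>x\<close>, with \<open>c i j\<close> the
    indicator of \<open>A i\<close> at \<open>x j\<close>.\<close>
  also have "\<dots> = (\<integral>x. (\<Sum>\<pi>\<in>?\<Pi>. \<phi> x * (\<Prod>j\<in>?I. indicator (A (\<pi> j)) (x j))) \<partial>P)"
    by (subst ryser_formula) (simp_all add: sum_distrib_left)
  also have "\<dots> = (\<Sum>\<pi>\<in>?\<Pi>. \<integral>x. \<phi> x * (\<Prod>j\<in>?I. indicator (A (\<pi> j)) (x j)) \<partial>P)"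
  proof (rule Bochner_Integration.integral_sum)
    fix \<pi> assume "\<pi> \<in> ?\<Pi>"
    then have A\<pi>: "A (\<pi> j) \<in> sets borel" if "j \<in> ?I" for j
      using A that permutes_in_image[of \<pi> ?I] by blast
    have "\<bar>\<Prod>j\<in>?I. indicator (A (\<pi> j)) (x j) :: real\<bar> \<le> 1" for x :: "nat \<Rightarrow> real ^ 'd"
      by (simp add: abs_prod prod_le_1 indicator_le_1)
    then show "integrable P (\<lambda>x. \<phi> x * (\<Prod>j\<in>?I. indicator (A (\<pi> j)) (x j)))"
      by (rule int[rotated])
        (use A\<pi> in measurable)
  qed
  also have "\<dots> = fact n * (\<integral>x. \<phi> x * (\<Prod>j\<in>?I. indicator (A j) (x j)) \<partial>P)"
    using card_permutations[of ?I n] by (simp add: sym_int)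
  finally show ?thesis by simp
qed

text \<open>Since \<open>ennreal\<close> sends negative numbers to 0, the two sides are the
  integrals of the positive and negative parts. Both are finite and their difference is the integral
  of \<open>f\<close>.\<close>

lemma nn_integral_eq_neg_if_integral_eq_0:
  fixes f :: "'a \<Rightarrow> real"
  assumes "integrable M f" "(\<integral>x. f x \<partial>M) = 0"
  shows "(\<integral>\<^sup>+x. ennreal (f x) \<partial>M) = (\<integral>\<^sup>+x. ennreal (- f x) \<partial>M)"
proof -
  have "(\<integral>\<^sup>+x. ennreal (f x) \<partial>M) \<noteq> \<infinity>" "(\<integral>\<^sup>+x. ennreal (- f x) \<partial>M) \<noteq> \<infinity>"
    using assms(1) by (auto simp: real_integrable_def)
  moreover have "enn2real (\<integral>\<^sup>+x. ennreal (f x) \<partial>M) = enn2real (\<integral>\<^sup>+x. ennreal (- f x) \<partial>M)"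
    using real_lebesgue_integral_def[OF assms(1)] assms(2) by simp
  ultimately show ?thesis
    by (metis ennreal_enn2real infinity_ennreal_def top.not_eq_extremum)
qed

text \<open>The positive and negative parts of \<open>f\<close>, taken as densities, give finite
  measures that agree on all boxes and hence everywhere. Uniqueness of densities makes the two parts
  equal almost everywhere, which forces \<open>f\<close> to vanish there.\<close>

lemma AE_eq_0_if_box_integrals_eq_0:
  fixes f :: "('i \<Rightarrow> 'a) \<Rightarrow> real"
  assumes I: "finite I" and M: "\<And>i. prob_space (M i)"
    and f [measurable]: "integrable (PiM I M) f"
    and box: "\<And>A. (\<And>i. i \<in> I \<Longrightarrow> A i \<in> sets (M i)) \<Longrightarrow>
       (\<integral>x. f x * (\<Prod>i\<in>I. indicator (A i) (x i)) \<partial>PiM I M) = 0"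
  shows "AE x in PiM I M. f x = 0"
proof -
  interpret P: prob_space "PiM I M" by (intro prob_space_PiM M)
  have box_ind: "indicator (Pi\<^sub>E I A) x = (\<Prod>i\<in>I. indicator (A i) (x i) :: real)"
    if "x \<in> space (PiM I M)" for A x
    using that I by (auto simp: indicator_def space_PiM PiE_iff)
  have "density (PiM I M) (\<lambda>x. ennreal (f x)) = density (PiM I M) (\<lambda>x. ennreal (- f x))"
  proof (rule measure_eqI_PiM_finite[where A = "\<lambda>_. space (PiM I M)"])
    fix A assume A: "\<And>i. i \<in> I \<Longrightarrow> A i \<in> sets (M i)"
    have [measurable]: "Pi\<^sub>E I A \<in> sets (PiM I M)" using A I by (intro sets_PiM_I_finite)
    let ?g = "\<lambda>x. indicator (Pi\<^sub>E I A) x * f x"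
    have "(\<integral>x. ?g x \<partial>PiM I M) = (\<integral>x. f x * (\<Prod>i\<in>I. indicator (A i) (x i)) \<partial>PiM I M)"
      by (intro Bochner_Integration.integral_cong refl) (simp add: box_ind)
    then have "(\<integral>\<^sup>+x. ennreal (?g x) \<partial>PiM I M) = (\<integral>\<^sup>+x. ennreal (- ?g x) \<partial>PiM I M)"
      using box[OF A] integrable_mult_indicator[OF _ f, of "Pi\<^sub>E I A"]
      by (intro nn_integral_eq_neg_if_integral_eq_0) auto
    \<comment> \<open>The factor \<open>c\<close> treats both parts at once, with the values 1 and
      -1.\<close>
    moreover have "(\<integral>\<^sup>+x. ennreal (c * f x) * indicator (Pi\<^sub>E I A) x \<partial>PiM I M)
       = (\<integral>\<^sup>+x. ennreal (c * ?g x) \<partial>PiM I M)" for c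
      by (intro nn_integral_cong) (simp add: indicator_def)
    from this[of 1] this[of "-1"]
    have "(\<integral>\<^sup>+x. ennreal (f x) * indicator (Pi\<^sub>E I A) x \<partial>PiM I M) = (\<integral>\<^sup>+x. ennreal (?g x) \<partial>PiM I M)"
      "(\<integral>\<^sup>+x. ennreal (- f x) * indicator (Pi\<^sub>E I A) x \<partial>PiM I M) = (\<integral>\<^sup>+x. ennreal (- ?g x) \<partial>PiM I M)"
      by simp_all
    ultimately show "emeasure (density (PiM I M) (\<lambda>x. ennreal (f x))) (Pi\<^sub>E I A)
      = emeasure (density (PiM I M) (\<lambda>x. ennreal (- f x))) (Pi\<^sub>E I A)"
      by (simp add: emeasure_density)
  next
    \<comment> \<open>The measures are finite, so the constant sequence of the whole space, itself a
      box, serves as the exhausting sequence.\<close>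
    show "range (\<lambda>_::nat. space (PiM I M)) \<subseteq> prod_algebra I M"
      using prod_algebraI_finite[OF I, of "\<lambda>i. space (M i)" M] by (auto simp: space_PiM)
    show "emeasure (density (PiM I M) (\<lambda>x. ennreal (f x))) (space (PiM I M)) \<noteq> \<infinity>"
      using f by (auto simp: emeasure_density real_integrable_def cong: nn_integral_cong)
  qed (use I in auto)
  then have "AE x in PiM I M. ennreal (f x) = ennreal (- f x)"
    by (subst (asm) P.density_unique_iff) auto
  then show ?thesis
  proof eventually_elim
    case (elim x)
    then show ?case by (cases "0 \<le> f x") (auto simp: ennreal_neg)
  qed
qed

text \<open>The function \<open>g \<circ> T\<close> inherits almost sure symmetry from
  \<open>T\<close>, so all its box integrals vanish under every law of the family.\<close>

lemma order_statistic_complete: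
  assumes T: "order_statistic n (T :: (nat \<Rightarrow> real ^ 'd) \<Rightarrow> _)"
  shows "complete_statistic (iid_laws n) (sample_space n) (sample_space n) T"
  unfolding complete_statistic_def
proof (intro conjI allI impI ballI)
  show T_meas [measurable]: "T \<in> sample_space n \<rightarrow>\<^sub>M sample_space n"
    using T by (simp add: order_statistic_def)
  fix g :: "(nat \<Rightarrow> real ^ 'd) \<Rightarrow> real" and P :: "(nat \<Rightarrow> real ^ 'd) measure"
  assume g [measurable]: "g \<in> borel_measurable (sample_space n)"
    and H: "\<forall>P\<in>iid_laws n. integrable P (\<lambda>x. g (T x)) \<and> (\<integral>x. g (T x) \<partial>P) = 0"
    and "P \<in> iid_laws n"
  then obtain \<mu> where \<mu>: "\<mu> \<in> ac_probability_measures" "P = PiM {1..n} (\<lambda>_. \<mu>)"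
    by (auto simp: iid_laws_def)
  interpret ac_sample \<mu> n by unfold_locales (rule \<mu>)
  have int: "integrable (PiM {1..n} (\<lambda>_. \<mu>)) (\<lambda>x. g (T x))"
    using H \<mu> by (auto simp: iid_laws_def)
  show "AE x in P. g (T x) = 0"
    unfolding \<mu>(2)
  proof (rule AE_eq_0_if_box_integrals_eq_0[OF _ prob_\<mu> int])
    fix A :: "nat \<Rightarrow> (real ^ 'd) set" assume A: "\<And>i. i \<in> {1..n} \<Longrightarrow> A i \<in> sets \<mu>"
    show "(\<integral>x. g (T x) * (\<Prod>i\<in>{1..n}. indicator (A i) (x i)) \<partial>PiM {1..n} (\<lambda>_. \<mu>)) = 0"
    proof (rule integral_box_eq_0[OF _ int])
      show "AE x in PiM {1..n} (\<lambda>_. \<mu>). \<forall>\<pi>. \<pi> permutes {1..n} \<longrightarrow> g (T (rearrange n x \<pi>)) = g (T x)"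
        using AE_order_statistic_rearrange[OF T] by eventually_elim simp
    qed (use A H in \<open>auto simp: sets_\<mu> iid_laws_def\<close>)
  qed simp
qed

section \<open>Optimal assignments\<close>

text \<open>Hyperplanes are Lebesgue null, and absolute continuity makes them \<mu>-null.\<close>

lemma (in ac_sample) AE_hyperplane:
  assumes v: "v \<noteq> 0"
  shows "AE y in \<mu>. y \<bullet> v \<noteq> c"
proof -
  have "{y. v \<bullet> y = c} \<in> null_sets lborel"
    using negligible_hyperplane[of v c] v
    by (auto simp: negligible_iff_null_sets null_sets_completion_iff closed_hyperplane)
  then have "{y. v \<bullet> y = c} \<in> null_sets \<mu>"
    using ac_\<mu> by (auto simp: absolutely_continuous_def)
  then show ?thesis by (rule AE_I') (auto simp: inner_commute)
qed

text \<open>Coordinate \<open>k\<close> is integrated first. With the others fixed, equality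
  confines it to a hyperplane with normal \<open>v k\<close>, which has mass zero.\<close>

lemma (in ac_sample) AE_sum_inner_neq:
  fixes v :: "nat \<Rightarrow> real ^ 'd"
  assumes k: "k \<in> {1..n}" "v k \<noteq> 0"
  shows "AE x in P. (\<Sum>i=1..n. x i \<bullet> v i) \<noteq> c"
proof -
  interpret product_sigma_finite "\<lambda>_. \<mu>"
    by (simp add: product_sigma_finite_def prob_\<mu> prob_space_imp_sigma_finite)
  let ?J = "{1..n} - {k}"
  have ins: "insert k ?J = {1..n}" using k by auto
  define N where "N = {x\<in>space P. (\<Sum>i=1..n. x i \<bullet> v i) = c}"
  have N [measurable]: "N \<in> sets P" unfolding N_def by measurable
  have "emeasure P N = (\<integral>\<^sup>+x. indicator N x \<partial>PiM (insert k ?J) (\<lambda>_. \<mu>))"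
    unfolding ins by simp
  also have "\<dots> = (\<integral>\<^sup>+x. \<integral>\<^sup>+y. indicator N (x(k := y)) \<partial>\<mu> \<partial>PiM ?J (\<lambda>_. \<mu>))"
    by (intro product_nn_integral_insert) (simp_all add: insert_absorb[OF k(1)])
  also have "\<dots> = (\<integral>\<^sup>+x. 0 \<partial>PiM ?J (\<lambda>_. \<mu>))"
  proof (intro nn_integral_cong)
    fix x
    have "AE y in \<mu>. y \<bullet> v k \<noteq> c - (\<Sum>i\<in>?J. x i \<bullet> v i)"
      by (rule AE_hyperplane) (rule k)
    then have "AE y in \<mu>. indicator N (x(k := y)) = (0::ennreal)"
    proof eventually_elim
      case (elim y)
      have "(\<Sum>i=1..n. (x(k := y)) i \<bullet> v i) = y \<bullet> v k + (\<Sum>i\<in>?J. x i \<bullet> v i)"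
        using k(1) by (subst sum.remove[of _ k]) auto
      with elim have "x(k := y) \<notin> N" by (simp add: N_def)
      then show ?case by simp
    qed
    then have "(\<integral>\<^sup>+y. indicator N (x(k := y)) \<partial>\<mu>) = (\<integral>\<^sup>+y. 0 \<partial>\<mu>)"
      by (rule nn_integral_cong_AE)
    then show "(\<integral>\<^sup>+y. indicator N (x(k := y)) \<partial>\<mu>) = 0" by simp
  qed
  finally have "N \<in> null_sets P" using N by (simp add: null_sets_def)
  then show ?thesis by (rule AE_I') (auto simp: N_def)
qed

lemma optimal_assignments_nonempty: "optimal_assignments n h x \<noteq> {}"
proof -
  have "{\<sigma>. \<sigma> permutes {1..n}} \<noteq> {}" using permutes_id[of "{1..n}"] by blast
  from ex_is_arg_min_if_finite[OF finite_perms this]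
  show ?thesis by (auto simp: optimal_assignments_def)
qed

lemma optimal_assignments_iff:
  "\<sigma> \<in> optimal_assignments n h x \<longleftrightarrow> \<sigma> permutes {1..n} \<and>
     (\<forall>\<tau>. \<tau> permutes {1..n} \<longrightarrow>
       (\<Sum>i=1..n. (norm (x i - h (\<sigma> i)))\<^sup>2) \<le> (\<Sum>i=1..n. (norm (x i - h (\<tau> i)))\<^sup>2))"
  by (auto simp: optimal_assignments_def is_arg_min_linorder)

text \<open>Links the unrestricted tuple of observations with its restriction to
  \<open>{1..n}\<close>, which is the point of the sample space.\<close>

lemma optimal_assignments_cong:
  assumes "\<And>i. i \<in> {1..n} \<Longrightarrow> x i = y i"
  shows "optimal_assignments n h x = optimal_assignments n h y"
proof -
  have "(\<Sum>i=1..n. (norm (x i - h (\<sigma> i)))\<^sup>2) = (\<Sum>i=1..n. (norm (y i - h (\<sigma> i)))\<^sup>2)" for \<sigma>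
    using assms by (intro sum.cong) auto
  then show ?thesis by (simp add: set_eq_iff optimal_assignments_iff)
qed

lemma assignment_cost_rearrange:
  assumes "\<pi> permutes {1..n}"
  shows "(\<Sum>i=1..n. (norm (rearrange n x \<pi> i - h ((\<sigma> \<circ> \<pi>) i)))\<^sup>2)
       = (\<Sum>i=1..n. (norm (x i - h (\<sigma> i)))\<^sup>2)"
  using sum.permute[OF assms, of "\<lambda>i. (norm (x i - h (\<sigma> i)))\<^sup>2"]
  by (simp add: rearrange_def comp_def)

text \<open>A competitor \<open>\<tau>\<close> for the rearranged sample has the same cost as
  \<open>\<tau> \<circ> inv \<pi>\<close> for the original one, so relabelling matches the two
  minimisation problems.\<close>

lemma optimal_assignments_rearrange:
  assumes \<pi>: "\<pi> permutes {1..n}" and \<sigma>: "\<sigma> \<in> optimal_assignments n h x"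
  shows "\<sigma> \<circ> \<pi> \<in> optimal_assignments n h (rearrange n x \<pi>)"
  unfolding optimal_assignments_iff
proof (intro conjI allI impI)
  show "\<sigma> \<circ> \<pi> permutes {1..n}"
    using \<pi> \<sigma> by (auto simp: optimal_assignments_iff intro: permutes_compose)
  fix \<tau> assume \<tau>: "\<tau> permutes {1..n}"
  have "\<tau> \<circ> inv \<pi> permutes {1..n}" using \<tau> \<pi> by (intro permutes_compose permutes_inv)
  moreover have "\<tau> \<circ> inv \<pi> \<circ> \<pi> = \<tau>" using permutes_inverses(2)[OF \<pi>] by (simp add: fun_eq_iff)
  ultimately have "(\<Sum>i=1..n. (norm (x i - h (\<sigma> i)))\<^sup>2)
      \<le> (\<Sum>i=1..n. (norm (x i - h ((\<tau> \<circ> inv \<pi>) i)))\<^sup>2)"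
    and eq: "(\<Sum>i=1..n. (norm (x i - h ((\<tau> \<circ> inv \<pi>) i)))\<^sup>2)
      = (\<Sum>i=1..n. (norm (rearrange n x \<pi> i - h (\<tau> i)))\<^sup>2)"
    using \<sigma> assignment_cost_rearrange[OF \<pi>, of x h "\<tau> \<circ> inv \<pi>"]
    by (simp_all only: optimal_assignments_iff)
  then show "(\<Sum>i=1..n. (norm (rearrange n x \<pi> i - h ((\<sigma> \<circ> \<pi>) i)))\<^sup>2)
      \<le> (\<Sum>i=1..n. (norm (rearrange n x \<pi> i - h (\<tau> i)))\<^sup>2)"
    by (simp only: assignment_cost_rearrange[OF \<pi>])
qed

text \<open>The squared norms of the observations cancel in the difference of two costs, which is
  therefore affine in \<open>x\<close>; injectivity of \<open>h\<close> makes it nonconstant for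
  distinct assignments. Finitely many pairs leave a single null set.\<close>

lemma (in ac_sample) AE_optimal_assignment_unique:
  assumes h: "inj_on h {1..n}"
  shows "AE x in P. \<forall>\<sigma>\<in>optimal_assignments n h x. \<forall>\<tau>\<in>optimal_assignments n h x. \<sigma> = \<tau>"
proof -
  let ?\<Pi> = "{\<pi>. \<pi> permutes {1..n}}"
  let ?cost = "\<lambda>x \<sigma>. \<Sum>i=1..n. (norm (x i - h (\<sigma> i)))\<^sup>2"
  have neq: "AE x in P. ?cost x \<sigma> \<noteq> ?cost x \<tau>"
    if \<sigma>: "\<sigma> permutes {1..n}" and \<tau>: "\<tau> permutes {1..n}" and "\<sigma> \<noteq> \<tau>" for \<sigma> \<tau>
  proof -
    obtain k where k: "\<sigma> k \<noteq> \<tau> k" using \<open>\<sigma> \<noteq> \<tau>\<close> by auto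
    then have k_in: "k \<in> {1..n}" using permutes_not_in[OF \<sigma>, of k] permutes_not_in[OF \<tau>, of k] by metis
    have "h (\<sigma> k) \<noteq> h (\<tau> k)"
      using inj_onD[OF h, of "\<sigma> k" "\<tau> k"] k k_in permutes_in_image[OF \<sigma>] permutes_in_image[OF \<tau>] by blast
    \<comment> \<open>The constant on the right is the value of the linear part at which the two
      costs would coincide.\<close>
    then have "AE x in P. (\<Sum>i=1..n. x i \<bullet> (h (\<sigma> i) - h (\<tau> i)))
        \<noteq> ((\<Sum>i=1..n. (norm (h (\<sigma> i)))\<^sup>2) - (\<Sum>i=1..n. (norm (h (\<tau> i)))\<^sup>2)) / 2"
      using k_in by (intro AE_sum_inner_neq) auto
    then show ?thesis
    proof eventually_elim
      case (elim x)
      have "?cost x \<sigma> - ?cost x \<tau> = (\<Sum>i=1..n. (norm (h (\<sigma> i)))\<^sup>2) - (\<Sum>i=1..n. (norm (h (\<tau> i)))\<^sup>2)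
         - 2 * (\<Sum>i=1..n. x i \<bullet> (h (\<sigma> i) - h (\<tau> i)))"
        by (simp add: power2_norm_eq_inner inner_diff inner_commute sum_subtractf sum.distrib
            sum_distrib_left algebra_simps)
      with elim show ?case by auto
    qed
  qed
  have "AE x in P. \<forall>\<sigma>\<in>?\<Pi>. \<forall>\<tau>\<in>?\<Pi>. \<sigma> \<noteq> \<tau> \<longrightarrow> ?cost x \<sigma> \<noteq> ?cost x \<tau>"
    using neq by (intro AE_finite_allI finite_perms) (auto intro: AE_impI)
  then show ?thesis
  proof eventually_elim
    case (elim x)
    show ?case
    proof (intro ballI, rule ccontr)
      fix \<sigma> \<tau> assume opt: "\<sigma> \<in> optimal_assignments n h x" "\<tau> \<in> optimal_assignments n h x" and "\<sigma> \<noteq> \<tau>"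
      then have "?cost x \<sigma> = ?cost x \<tau>" unfolding optimal_assignments_iff by (intro antisym) auto
      with elim opt \<open>\<sigma> \<noteq> \<tau>\<close> show False by (auto simp: optimal_assignments_iff)
    qed
  qed
qed

lemma optimal_assignment_sets [measurable]:
  "{x\<in>space (sample_space n). \<sigma> \<in> optimal_assignments n h x} \<in> sets (sample_space n)"
proof -
  have "{x\<in>space (sample_space n). \<sigma> \<in> optimal_assignments n h x}
     = {x\<in>space (sample_space n). \<sigma> permutes {1..n} \<and> (\<forall>\<tau>\<in>{\<tau>. \<tau> permutes {1..n}}.
       (\<Sum>i=1..n. (norm (x i - h (\<sigma> i)))\<^sup>2) \<le> (\<Sum>i=1..n. (norm (x i - h (\<tau> i)))\<^sup>2))}"
    by (simp add: optimal_assignments_iff)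
  also have "\<dots> \<in> sets (sample_space n)"
    using finite_perms[of n] by (intro sets.sets_Collect sets.sets_Collect_finite_All) measurable
  finally show ?thesis .
qed

text \<open>The events \<open>E \<sigma>\<close> almost surely partition the sample space.
  Rearrangement carries one to another while \<open>D\<close>, being determined by the order
  statistic, is almost surely preserved; so they cut \<open>D\<close> into \<open>n!\<close> pieces
  of equal probability.\<close>

lemma (in ac_sample) prob_optimal_assignment_and_order_statistic:
  assumes T: "order_statistic n T" and h: "inj_on h {1..n}"
    and \<rho>: "\<rho> permutes {1..n}" and C [measurable]: "C \<in> sets (sample_space n)"
  shows "measure P {x\<in>space P. \<rho> \<in> optimal_assignments n h x \<and> T x \<in> C}
       = measure P {x\<in>space P. T x \<in> C} / fact n"
proof -
  let ?S = "sample_space n :: (nat \<Rightarrow> real ^ 'd) measure"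
  let ?\<Pi> = "{\<pi>. \<pi> permutes {1..n}}"
  have [measurable]: "T \<in> ?S \<rightarrow>\<^sub>M ?S" using T by (simp add: order_statistic_def)
  define E where "E \<sigma> = {x\<in>space ?S. \<sigma> \<in> optimal_assignments n h x}" for \<sigma>
  define D where "D = {x\<in>space ?S. T x \<in> C}"
  have [measurable]: "E \<sigma> \<in> sets ?S" "D \<in> sets ?S" for \<sigma> unfolding E_def D_def by measurable
  note unique = AE_optimal_assignment_unique[OF h]
  have E_rearrange: "(\<integral>x. indicator (E (\<sigma> \<circ> \<pi>)) x * indicator D x \<partial>P)
      = (\<integral>x. (indicator (E \<sigma>) x * indicator D x :: real) \<partial>P)"
    if \<sigma>: "\<sigma> permutes {1..n}" and \<pi>: "\<pi> permutes {1..n}" for \<sigma> \<pi>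
  proof -
    have \<pi>i: "inv \<pi> permutes {1..n}" using \<pi> by (rule permutes_inv)
    note measurable_rearrange[OF \<pi>, measurable]
    have "(\<integral>x. (indicator (E (\<sigma> \<circ> \<pi>)) x * indicator D x :: real) \<partial>P)
       = (\<integral>x. indicator (E (\<sigma> \<circ> \<pi>)) (rearrange n x \<pi>) * indicator D (rearrange n x \<pi>) \<partial>P)"
      by (rule integral_rearrange[OF \<pi>, symmetric,
            where f = "\<lambda>x. indicator (E (\<sigma> \<circ> \<pi>)) x * indicator D x"]) measurable
    also have "\<dots> = (\<integral>x. (indicator (E \<sigma>) x * indicator D x :: real) \<partial>P)"
    proof (rule integral_cong_AE)
      show "AE x in P. indicator (E (\<sigma> \<circ> \<pi>)) (rearrange n x \<pi>) * indicator D (rearrange n x \<pi>)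
         = (indicator (E \<sigma>) x * indicator D x :: real)"
        using AE_order_statistic_rearrange[OF T] AE_space
      proof eventually_elim
        case (elim x)
        have x: "x \<in> space ?S" using elim(2) by (simp only: space_P)
        have r: "rearrange n x \<pi> \<in> space ?S" by (rule rearrange_in_space[OF x \<pi>])
        \<comment> \<open>Undoing the rearrangement supplies the converse direction of the
          equivalence below.\<close>
        have "rearrange n (rearrange n x \<pi>) (inv \<pi>) = x"
          using x permutes_inv_o(1)[OF \<pi>] by (simp add: rearrange_rearrange[OF \<pi>i])
            (simp add: rearrange_def space_PiM PiE_restrict)
        moreover have "\<sigma> \<circ> \<pi> \<circ> inv \<pi> = \<sigma>" using permutes_inv_o(1)[OF \<pi>] by (simp add: comp_assoc)
        ultimately have "\<sigma> \<circ> \<pi> \<in> optimal_assignments n h (rearrange n x \<pi>)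
            \<longleftrightarrow> \<sigma> \<in> optimal_assignments n h x"
          using optimal_assignments_rearrange[OF \<pi>, of \<sigma> h x]
            optimal_assignments_rearrange[OF \<pi>i, of "\<sigma> \<circ> \<pi>" h "rearrange n x \<pi>"] by auto
        moreover have "T (rearrange n x \<pi>) = T x" using elim(1) \<pi> by blast
        ultimately show ?case using x r by (simp add: E_def D_def indicator_def)
      qed
    qed measurable
    finally show ?thesis .
  qed
  \<comment> \<open>Every assignment is reached from the identity, so all pieces are compared with
    the one for \<open>id\<close>.\<close>
  have eq: "(\<integral>x. indicator (E \<sigma>) x * indicator D x \<partial>P)
     = (\<integral>x. (indicator (E \<rho>) x * indicator D x :: real) \<partial>P)" if \<sigma>: "\<sigma> permutes {1..n}" for \<sigma>
    using E_rearrange[OF permutes_id \<sigma>] E_rearrange[OF permutes_id \<rho>] by simp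
  have "measure P D = (\<integral>x. indicator D x \<partial>P)" by simp
  also have "\<dots> = (\<integral>x. (\<Sum>\<sigma>\<in>?\<Pi>. indicator (E \<sigma>) x * indicator D x) \<partial>P)"
  proof (rule integral_cong_AE)
    show "AE x in P. indicator D x = (\<Sum>\<sigma>\<in>?\<Pi>. indicator (E \<sigma>) x * indicator D x :: real)"
      using unique AE_space
    proof eventually_elim
      case (elim x)
      have x: "x \<in> space ?S" using elim(2) by (simp only: space_P)
      obtain \<sigma> where \<sigma>: "\<sigma> \<in> optimal_assignments n h x" using optimal_assignments_nonempty by blast
      then have \<sigma>': "\<sigma> \<in> ?\<Pi>" by (simp add: optimal_assignments_iff)
      \<comment> \<open>Existence of an optimal assignment gives at least one nonzero term on
        \<open>D\<close>, uniqueness at most one.\<close>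
      have "(\<Sum>\<tau>\<in>?\<Pi>. indicator (E \<tau>) x * indicator D x :: real)
         = (\<Sum>\<tau>\<in>?\<Pi>. if \<tau> = \<sigma> then indicator D x else 0)"
        using elim(1) x \<sigma> by (intro sum.cong refl) (auto simp: E_def indicator_def)
      also have "\<dots> = indicator D x" using \<sigma>' finite_perms by (simp add: sum.delta)
      finally show ?case by simp
    qed
  qed measurable
  also have "\<dots> = (\<Sum>\<sigma>\<in>?\<Pi>. \<integral>x. (indicator (E \<sigma>) x * indicator D x :: real) \<partial>P)"
  proof (rule Bochner_Integration.integral_sum)
    fix \<sigma>
    show "integrable P (\<lambda>x. indicator (E \<sigma>) x * indicator D x :: real)"
    proof (rule P.integrable_const_bound[where B = 1])
      show "AE x in P. norm (indicator (E \<sigma>) x * indicator D x :: real) \<le> 1" by (simp add: indicator_def)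
    qed measurable
  qed
  also have "\<dots> = fact n * (\<integral>x. (indicator (E \<rho>) x * indicator D x :: real) \<partial>P)"
    using card_permutations[of "{1..n}" n] by (simp add: eq)
  also have "(\<integral>x. (indicator (E \<rho>) x * indicator D x :: real) \<partial>P) = measure P (E \<rho> \<inter> D)"
    by (simp add: indicator_inter_arith[symmetric])
  also have "E \<rho> \<inter> D = {x\<in>space P. \<rho> \<in> optimal_assignments n h x \<and> T x \<in> C}"
    unfolding E_def D_def space_P by auto
  also have "D = {x\<in>space P. T x \<in> C}" unfolding D_def space_P ..
  finally show ?thesis by simp
qed

section \<open>Independence of ranks and order statistic\<close>

text \<open>For nonempty \<open>I\<close> this is the characterisation of independence by the
  product law. For empty \<open>I\<close> both sides are the unit mass at the function that is
  \<open>undefined\<close> everywhere.\<close>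

lemma (in prob_space) distr_iid_sample:
  assumes indep: "indep_vars (\<lambda>_. N) X I"
    and law: "\<And>i. i \<in> I \<Longrightarrow> distr M N (X i) = \<mu>"
  shows "distr M (PiM I (\<lambda>_. N)) (\<lambda>\<omega>. \<lambda>i\<in>I. X i \<omega>) = PiM I (\<lambda>_. \<mu>)"
proof (cases "I = {}")
  case True
  let ?Q = "PiM {} (\<lambda>_. N)"
  have "distr M ?Q (\<lambda>\<omega>. \<lambda>i\<in>{}. X i \<omega>) = PiM {} (\<lambda>_. \<mu>)"
  proof (rule measure_eqI)
    fix A assume "A \<in> sets (distr M ?Q (\<lambda>\<omega>. \<lambda>i\<in>{}. X i \<omega>))"
    then have A: "A = {} \<or> A = {\<lambda>_. undefined}" by (auto simp: sets_PiM_empty)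
    have m: "(\<lambda>\<omega>. \<lambda>i\<in>{}. X i \<omega>) \<in> M \<rightarrow>\<^sub>M ?Q" by (rule measurable_restrict) simp
    show "emeasure (distr M ?Q (\<lambda>\<omega>. \<lambda>i\<in>{}. X i \<omega>)) A = emeasure (PiM {} (\<lambda>_. \<mu>)) A"
      using A by (auto simp: emeasure_distr[OF m] sets_PiM_empty emeasure_space_1 PiM_empty
          restrict_def vimage_def)
  qed (simp add: sets_PiM_empty)
  with True show ?thesis by simp
next
  case False
  have rv: "\<And>i. i \<in> I \<Longrightarrow> random_variable N (X i)" using indep by (auto simp: indep_vars_def)
  have "distr M (PiM I (\<lambda>_. N)) (\<lambda>\<omega>. \<lambda>i\<in>I. X i \<omega>) = PiM I (\<lambda>i. distr M N (X i))"
    using indep_vars_iff_distr_eq_PiM'[OF False, where M' = "\<lambda>_. N" and X = X] rv indep by blast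
  also have "\<dots> = PiM I (\<lambda>_. \<mu>)" using law by (intro PiM_cong) auto
  finally show ?thesis .
qed

lemma Int_stable_vimages: "Int_stable {f -` A \<inter> \<Omega> |A. A \<in> sets N}"
proof (rule Int_stableI)
  fix a b assume "a \<in> {f -` A \<inter> \<Omega> |A. A \<in> sets N}" "b \<in> {f -` A \<inter> \<Omega> |A. A \<in> sets N}"
  then obtain A B where "A \<in> sets N" "B \<in> sets N" "a = f -` A \<inter> \<Omega>" "b = f -` B \<inter> \<Omega>"
    by blast
  then show "a \<inter> b \<in> {f -` A \<inter> \<Omega> |A. A \<in> sets N}"
    by (intro CollectI exI[of _ "A \<inter> B"]) auto
qed

text \<open>The preimages under each variable form an intersection-stable generator, so the product
  rule on them extends to the generated sigma-algebras.\<close>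

lemma (in prob_space) indep_varI_prob:
  assumes X [measurable]: "random_variable S X" and Y [measurable]: "random_variable N Y"
    and prod: "\<And>A B. A \<in> sets S \<Longrightarrow> B \<in> sets N \<Longrightarrow>
      prob {\<omega>\<in>space M. X \<omega> \<in> A \<and> Y \<omega> \<in> B} = prob {\<omega>\<in>space M. X \<omega> \<in> A} * prob {\<omega>\<in>space M. Y \<omega> \<in> B}"
  shows "indep_var S X N Y"
  unfolding indep_var_eq
proof (intro conjI X Y indep_set_sigma_sets indep_setI)
  fix a b assume "a \<in> {X -` A \<inter> space M |A. A \<in> sets S}" "b \<in> {Y -` A \<inter> space M |A. A \<in> sets N}"
  then obtain A B where AB: "A \<in> sets S" "B \<in> sets N" "a = X -` A \<inter> space M" "b = Y -` B \<inter> space M"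
    by blast
  have "a = {\<omega>\<in>space M. X \<omega> \<in> A}" "b = {\<omega>\<in>space M. Y \<omega> \<in> B}"
    "a \<inter> b = {\<omega>\<in>space M. X \<omega> \<in> A \<and> Y \<omega> \<in> B}"
    unfolding AB(3,4) by auto
  with prod[OF AB(1,2)] show "prob (a \<inter> b) = prob a * prob b" by simp
qed (auto intro: Int_stable_vimages measurable_sets)

theorem proposition2p2:
  fixes M :: "'a measure" and \<mu> :: "(real ^ 'd) measure"
    and X :: "nat \<Rightarrow> 'a \<Rightarrow> real ^ 'd" and n :: nat
    and h :: "nat \<Rightarrow> real ^ 'd"
    and T :: "(nat \<Rightarrow> real ^ 'd) \<Rightarrow> (nat \<Rightarrow> real ^ 'd)"
    and \<sigma> :: "'a \<Rightarrow> nat \<Rightarrow> nat"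
  assumes M: "prob_space M"
    and \<mu>: "\<mu> \<in> ac_probability_measures"
    and X_indep: "prob_space.indep_vars M (\<lambda>_. borel) X {1..n}"
    and X_law: "\<And>i. i \<in> {1..n} \<Longrightarrow> distr M borel (X i) = \<mu>"
    and h_inj: "inj_on h {1..n}"
    and h_cube: "h ` {1..n} \<subseteq> cbox 0 1"
    and T: "order_statistic n T"
    and \<sigma>_meas: "\<sigma> \<in> M \<rightarrow>\<^sub>M count_space {\<pi>. \<pi> permutes {1..n}}"
    and \<sigma>_opt: "\<And>\<omega>. \<omega> \<in> space M \<Longrightarrow> \<sigma> \<omega> \<in> optimal_assignments n h (\<lambda>i. X i \<omega>)"
  shows "(complete_statistic (iid_laws n) (sample_space n) (sample_space n) T \<and>
          sufficient_statistic (iid_laws n) (sample_space n) (sample_space n) T) \<and>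
         distr M (count_space (grid_permutations n h)) (\<lambda>\<omega>. empirical_ranks n h (\<sigma> \<omega>))
           = uniform_count_measure (grid_permutations n h) \<and>
         prob_space.indep_var M
           (sample_space n) (\<lambda>\<omega>. empirical_ranks n h (\<sigma> \<omega>))
           (sample_space n) (\<lambda>\<omega>. T (\<lambda>i\<in>{1..n}. X i \<omega>))"
proof -
  let ?S = "sample_space n :: (nat \<Rightarrow> real ^ 'd) measure"
  let ?\<Pi> = "{\<pi>. \<pi> permutes {1..n}}"
  let ?G = "grid_permutations n h"
  interpret prob_space M by (rule M)
  interpret \<mu>: ac_sample \<mu> n by unfold_locales (rule \<mu>)
  define x where "x = (\<lambda>\<omega>. \<lambda>i\<in>{1..n}. X i \<omega>)"
  have law: "distr M ?S x = PiM {1..n} (\<lambda>_. \<mu>)"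
    unfolding x_def by (rule distr_iid_sample[OF X_indep X_law])
  have T_meas [measurable]: "T \<in> ?S \<rightarrow>\<^sub>M ?S" using T by (simp add: order_statistic_def)
  have x_meas [measurable]: "x \<in> M \<rightarrow>\<^sub>M ?S"
    unfolding x_def using X_indep by (intro measurable_restrict) (auto simp: indep_vars_def)
  note \<sigma>_meas [measurable]
  have prob_x: "prob {\<omega>\<in>space M. x \<omega> \<in> A} = measure (PiM {1..n} (\<lambda>_. \<mu>)) A" if "A \<in> sets ?S" for A
    unfolding law[symmetric] measure_distr[OF x_meas that] by (rule arg_cong[where f = prob]) auto
  have prob_T: "prob {\<omega>\<in>space M. T (x \<omega>) \<in> C} = measure \<mu>.P {y\<in>space \<mu>.P. T y \<in> C}"
    if [measurable]: "C \<in> sets ?S" for C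
  proof -
    have "{y\<in>space \<mu>.P. T y \<in> C} \<in> sets ?S" unfolding \<mu>.space_P by measurable
    from prob_x[OF this] show ?thesis
      using measurable_space[OF x_meas] by (simp add: \<mu>.space_P cong: conj_cong)
  qed
  have joint_event: "{\<omega>\<in>space M. \<sigma> \<omega> = \<rho> \<and> T (x \<omega>) \<in> C} \<in> events"
    if \<rho>: "\<rho> permutes {1..n}" and C [measurable]: "C \<in> sets ?S" for \<rho> C
  proof -
    have "{\<omega>\<in>space M. \<sigma> \<omega> = \<rho> \<and> T (x \<omega>) \<in> C}
        = (\<sigma> -` {\<rho>} \<inter> space M) \<inter> {\<omega>\<in>space M. T (x \<omega>) \<in> C}" by auto
    also have "\<dots> \<in> events" using \<rho> by (intro sets.Int measurable_sets[OF \<sigma>_meas]) auto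
    finally show ?thesis .
  qed
  \<comment> \<open>\<open>\<sigma>\<close> is an arbitrary measurable choice among optimal
    assignments. Almost sure uniqueness turns the event \<open>\<sigma> \<omega> = \<rho>\<close>
    into optimality of \<open>\<rho>\<close> for the sample, whose probability depends only on the
    law of \<open>x\<close>.\<close>
  have joint1: "prob {\<omega>\<in>space M. \<sigma> \<omega> = \<rho> \<and> T (x \<omega>) \<in> C} = prob {\<omega>\<in>space M. T (x \<omega>) \<in> C} / fact n"
    if \<rho>: "\<rho> permutes {1..n}" and C [measurable]: "C \<in> sets ?S" for \<rho> C
  proof -
    let ?E = "{y\<in>space ?S. \<rho> \<in> optimal_assignments n h y \<and> T y \<in> C}"
    have opt: "\<sigma> \<omega> \<in> optimal_assignments n h (x \<omega>)" if "\<omega> \<in> space M" for \<omega>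
      using \<sigma>_opt[OF that] optimal_assignments_cong[of n "x \<omega>" "\<lambda>i. X i \<omega>" h] by (simp add: x_def)
    have "AE y in distr M ?S x. \<forall>\<sigma>\<in>optimal_assignments n h y. \<forall>\<tau>\<in>optimal_assignments n h y. \<sigma> = \<tau>"
      unfolding law by (rule \<mu>.AE_optimal_assignment_unique[OF h_inj])
    then have unique: "AE \<omega> in M. \<forall>\<sigma>\<in>optimal_assignments n h (x \<omega>). \<forall>\<tau>\<in>optimal_assignments n h (x \<omega>). \<sigma> = \<tau>"
      by (rule AE_distrD[OF x_meas])
    have E [measurable]: "?E \<in> sets ?S"
      using sets.Int[OF optimal_assignment_sets[of n \<rho> h], of "{y\<in>space ?S. T y \<in> C}"]
      by (simp add: Collect_conj_eq Int_assoc Int_left_commute)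
    have "prob {\<omega>\<in>space M. \<sigma> \<omega> = \<rho> \<and> T (x \<omega>) \<in> C} = prob {\<omega>\<in>space M. x \<omega> \<in> ?E}"
    proof (rule finite_measure_eq_AE)
      show "AE \<omega> in M. \<omega> \<in> {\<omega>\<in>space M. \<sigma> \<omega> = \<rho> \<and> T (x \<omega>) \<in> C} \<longleftrightarrow> \<omega> \<in> {\<omega>\<in>space M. x \<omega> \<in> ?E}"
        using unique AE_space
      proof eventually_elim
        case (elim \<omega>)
        then show ?case using opt[of \<omega>] measurable_space[OF x_meas, of \<omega>] by auto
      qed
      show "{\<omega>\<in>space M. \<sigma> \<omega> = \<rho> \<and> T (x \<omega>) \<in> C} \<in> events" by (rule joint_event[OF \<rho> C])
    qed measurable
    also have "\<dots> = measure \<mu>.P {y\<in>space \<mu>.P. \<rho> \<in> optimal_assignments n h y \<and> T y \<in> C}"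
      unfolding prob_x[OF E] \<mu>.space_P ..
    also have "\<dots> = prob {\<omega>\<in>space M. T (x \<omega>) \<in> C} / fact n"
      unfolding prob_T[OF C]
      by (rule \<mu>.prob_optimal_assignment_and_order_statistic[OF T h_inj \<rho> C])
    finally show ?thesis .
  qed
  have joint: "prob {\<omega>\<in>space M. \<sigma> \<omega> \<in> A \<and> T (x \<omega>) \<in> C}
      = real (card A) / fact n * prob {\<omega>\<in>space M. T (x \<omega>) \<in> C}"
    if A: "A \<subseteq> ?\<Pi>" and C [measurable]: "C \<in> sets ?S" for A C
  proof -
    have fin: "finite A" using A finite_perms by (rule finite_subset)
    have "{\<omega>\<in>space M. \<sigma> \<omega> \<in> A \<and> T (x \<omega>) \<in> C} = (\<Union>\<rho>\<in>A. {\<omega>\<in>space M. \<sigma> \<omega> = \<rho> \<and> T (x \<omega>) \<in> C})" by auto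
    also have "prob \<dots> = (\<Sum>\<rho>\<in>A. prob {\<omega>\<in>space M. \<sigma> \<omega> = \<rho> \<and> T (x \<omega>) \<in> C})"
    proof (rule finite_measure_finite_Union[OF fin])
      show "(\<lambda>\<rho>. {\<omega>\<in>space M. \<sigma> \<omega> = \<rho> \<and> T (x \<omega>) \<in> C}) ` A \<subseteq> events" using A joint_event[OF _ C] by auto
    qed (auto simp: disjoint_family_on_def)
    also have "\<dots> = (\<Sum>\<rho>\<in>A. prob {\<omega>\<in>space M. T (x \<omega>) \<in> C} / fact n)"
      using A by (intro sum.cong refl joint1) auto
    finally show ?thesis by simp
  qed
  \<comment> \<open>The joint formula with \<open>C\<close> the whole space.\<close>
  have \<sigma>_unif: "prob {\<omega>\<in>space M. \<sigma> \<omega> \<in> A} = real (card A) / fact n" if "A \<subseteq> ?\<Pi>" for A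
  proof -
    have "T (x \<omega>) \<in> space ?S" if "\<omega> \<in> space M" for \<omega>
      using that by (intro measurable_space[OF T_meas] measurable_space[OF x_meas])
    then show ?thesis using joint[OF that sets.top] prob_space by (simp cong: conj_cong)
  qed
  have emp: "empirical_ranks n h = rearrange n h"
    by (simp add: fun_eq_iff empirical_ranks_def rearrange_def)
  have \<sigma>_perm: "\<sigma> \<omega> \<in> ?\<Pi>" if "\<omega> \<in> space M" for \<omega> using measurable_space[OF \<sigma>_meas that] by simp
  \<comment> \<open>The ranks are a function of \<open>\<sigma>\<close>, so events about them pull
    back to sets of permutations, where the joint formula factorises.\<close>
  have indep_ranks: "indep_var ?S (\<lambda>\<omega>. empirical_ranks n h (\<sigma> \<omega>)) ?S (\<lambda>\<omega>. T (x \<omega>))"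
  proof (rule indep_varI_prob)
    show "(\<lambda>\<omega>. empirical_ranks n h (\<sigma> \<omega>)) \<in> M \<rightarrow>\<^sub>M ?S"
      by (rule measurable_compose[OF \<sigma>_meas]) (auto simp: empirical_ranks_def space_PiM)
    fix A C assume "A \<in> sets ?S" and C: "C \<in> sets ?S"
    let ?A = "{\<pi>\<in>?\<Pi>. empirical_ranks n h \<pi> \<in> A}"
    have sub: "?A \<subseteq> ?\<Pi>" by auto
    have eqs: "{\<omega>\<in>space M. empirical_ranks n h (\<sigma> \<omega>) \<in> A \<and> T (x \<omega>) \<in> C}
        = {\<omega>\<in>space M. \<sigma> \<omega> \<in> ?A \<and> T (x \<omega>) \<in> C}"
      "{\<omega>\<in>space M. empirical_ranks n h (\<sigma> \<omega>) \<in> A} = {\<omega>\<in>space M. \<sigma> \<omega> \<in> ?A}"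
      using \<sigma>_perm by auto
    show "prob {\<omega>\<in>space M. empirical_ranks n h (\<sigma> \<omega>) \<in> A \<and> T (x \<omega>) \<in> C}
       = prob {\<omega>\<in>space M. empirical_ranks n h (\<sigma> \<omega>) \<in> A} * prob {\<omega>\<in>space M. T (x \<omega>) \<in> C}"
      by (simp only: eqs joint[OF sub C] \<sigma>_unif[OF sub])
  qed measurable
  have fin_G: "finite ?G" unfolding grid_permutations_def using finite_perms by simp
  have ranks_meas: "(\<lambda>\<omega>. empirical_ranks n h (\<sigma> \<omega>)) \<in> M \<rightarrow>\<^sub>M count_space ?G"
    by (rule measurable_compose[OF \<sigma>_meas]) (auto simp: emp grid_permutations_def)
  have "distr M (count_space ?G) (\<lambda>\<omega>. empirical_ranks n h (\<sigma> \<omega>)) = uniform_count_measure ?G"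
  proof (rule measure_eqI_finite[OF _ _ fin_G])
    fix g assume g: "g \<in> ?G"
    then obtain \<rho> where \<rho>: "\<rho> permutes {1..n}" "g = rearrange n h \<rho>" by (auto simp: grid_permutations_def)
    \<comment> \<open>Injectivity by counting: the image, \<open>?G\<close>, has \<open>n!\<close>
      elements, as many as there are permutations. Each point of \<open>?G\<close> thus comes from
      exactly one assignment.\<close>
    have inj: "inj_on (rearrange n h) ?\<Pi>"
      using card_grid_permutations[OF h_inj] card_permutations[of "{1..n}" n] finite_perms
      unfolding grid_permutations_def by (intro eq_card_imp_inj_on) auto
    have "(\<lambda>\<omega>. empirical_ranks n h (\<sigma> \<omega>)) -` {g} \<inter> space M = {\<omega>\<in>space M. \<sigma> \<omega> \<in> {\<rho>}}"
      using inj_onD[OF inj] \<rho> \<sigma>_perm by (auto simp: emp)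
    then have "emeasure (distr M (count_space ?G) (\<lambda>\<omega>. empirical_ranks n h (\<sigma> \<omega>))) {g}
        = ennreal (prob {\<omega>\<in>space M. \<sigma> \<omega> \<in> {\<rho>}})"
      using g by (subst emeasure_distr[OF ranks_meas]) (simp_all add: emeasure_eq_measure)
    also have "\<dots> = ennreal (1 / fact n)" using \<sigma>_unif[of "{\<rho>}"] \<rho> by simp
    also have "\<dots> = emeasure (uniform_count_measure ?G) {g}"
      using g fin_G by (subst emeasure_uniform_count_measure) (auto simp: card_grid_permutations[OF h_inj])
    finally show "emeasure (distr M (count_space ?G) (\<lambda>\<omega>. empirical_ranks n h (\<sigma> \<omega>))) {g}
        = emeasure (uniform_count_measure ?G) {g}" .
  qed (simp_all add: sets_uniform_count_measure)
  with order_statistic_complete[OF T] order_statistic_sufficient[OF T] indep_ranks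
  show ?thesis unfolding x_def by blast
qed

end
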